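(* Let $\delta\in(0,1)$ and let $\mathbf{D}=[\mathbf{B}\ \mathbf{A}]\in\mathbb{R}^{M_1\times M_2}$ satisfy Assumption 1 (stated in the context), with $n_o$ outliers $\mathbf{b}_1,\dots,\mathbf{b}_{n_o}$ (the first $n_o$ columns) and $n_i$ inliers lying in the $r$-dimensional subspace $\mathcal{U}$. Define $$\mathcal{A}=\sqrt{\tfrac{1}{2\pi}}\frac{n_i}{\sqrt r}-\sqrt{n_i}-\sqrt{\frac{n_i\log\frac1\delta}{2r-2}},$$ $$\sqrt{c_\delta}=3\max\Big(1,\sqrt{\tfrac{8M_1\pi}{(M_1-1)r}},\sqrt{\tfrac{8M_1\log (n_o/\delta)}{(M_1-1)r}}\Big),\quad \sqrt{c''_\delta}=3\max\Big(1,\sqrt{\tfrac{8M_1\pi}{M_1-1}},\sqrt{\tfrac{16M_1\log (n_o/\delta)}{M_1-1}}\Big),$$ $$\eta_\delta=\max\Big(\tfrac43\log\tfrac{2M_1}{\delta},\sqrt{4\tfrac{n_o}{M_1}\log\tfrac{2M_1}{\delta}}\Big).$$ Suppose that (i) $\mathcal{A}>2n_z'\sqrt{\frac{c_\delta r}{M_1}}+2\sqrt{\frac{n_o c_\delta r\log(n_o/\delta)}{M_1}}$; (ii) $\mathcal{A}>\Big[\frac{n_o}{M_1}+\sqrt{\frac{4n_o}{M_1}}+\sqrt{\frac{2n_o\log(1/\delta)}{(M_1-1)M_1}}+\sqrt{\frac{n_oc''_\delta\log(n_o/\delta)}{M_1^2}}+n_z'\sqrt{\frac{c''_\delta}{M_1^2}}+\sqrt{\frac{n_o\log(n_o/\delta)}{M_1^2}+\frac{\eta_\delta\log(n_o/\delta)}{M_1}}\Big]\sqrt{\frac{4M_1c_\delta}{M_1-c_\delta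 r}}$; (iii) $\mathcal{A}>\chi\frac{n_o}{\sqrt{M_1}}+2\sqrt{n_o}(1+\sqrt{\chi})+2\sqrt{\frac{2\chi n_o\log(1/\delta)}{M_1-1}}$. Then with probability at least $1-7\delta$, $$\max_{n_o<i\le M_2}\frac{1}{\|\mathbf{D}^T\mathbf{c}_i^*\|_1}<\min_{1\le j\le n_o}\frac{1}{\|\mathbf{D}^T\mathbf{c}_j^*\|_1},$$ i.e. every outlier has a strictly larger Innovation Value than every inlier, and $\mathcal{U}$ is recovered exactly (the span of the columns with the smallest Innovation Values, added in increasing order of Innovation Value until they span an $r$-dimensional subspace, equals $\mathcal{U}$).
   Context: $\mathbb{S}^{M_1-1}$ is the unit $\ell_2$-sphere in $\mathbb{R}^{M_1}$. $\mathcal{U}\subset\mathbb{R}^{M_1}$ is an $r$-dimensional subspace with orthonormal basis $\mathbf{U}\in\mathbb{R}^{M_1\times r}$. Assumption 1: $\mathbf{D}=[\mathbf{B}\ \mathbf{A}]$ with $\mathbf{B}\in\mathbb{R}^{M_1\times n_o}$, $\mathbf{A}\in\mathbb{R}^{M_1\times n_i}$, $M_2=n_o+n_i$; the columns of $\mathbf{A}$ (inliers) are drawn independently uniformly at random from $\mathcal{U}\cap\mathbb{S}^{M_1-1}$ and the columns of $\mathbf{B}$ (outliers) independently uniformly at random from $\mathbb{S}^{M_1-1}$. The columns of $\mathbf{D}$ are $\mathbf{d}_1,\dots,\mathbf{d}_{M_2}$ (so $\mathbf{d}_j=\mathbf{b}_j$ for $j\le n_o$). For each $j$, $\mathbf{c}_j^*$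 is an optimal point of $\min_{\mathbf{c}}\|\mathbf{c}^T\mathbf{D}\|_1$ subject to $\mathbf{c}^T\mathbf{d}_j=1$; the Innovation Value of $\mathbf{d}_j$ is $1/\|\mathbf{D}^T\mathbf{c}_j^*\|_1$. $\chi=\max_{1\le j\le n_o}\|\mathbf{c}_j^*\|_2$ and $n_z'=\max_{1\le j\le n_o}|\{i\in[n_o]:(\mathbf{c}_j^* )^T\mathbf{b}_i=0\}|$. $\log$ is the natural logarithm. *)

theory Defs
  imports "HOL-Probability.Probability"
begin

text \<open>Uniform (normalised surface) measure on the unit sphere of a Euclidean space,
  defined as the cone measure: the image of the uniform distribution on the open unit
  ball under radial projection x \<mapsto> x / norm x.\<close>
definition uniform_sphere :: "'n::euclidean_space measure" where
  "uniform_sphere = distr (uniform_measure lborel (ball 0 1)) borel (\<lambda>x. x /\<^sub>R norm x)"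

text \<open>Uniform distribution on the sphere of the subspace spanned by the orthonormal
  columns of Ub (an M1 x r matrix): image of the uniform distribution on the unit
  sphere of R^r under the isometry a \<mapsto> Ub a.\<close>
definition uniform_subspace_sphere :: "real^'r^'m \<Rightarrow> (real^'m) measure" where
  "uniform_subspace_sphere Ub = distr (uniform_sphere :: (real^'r) measure) borel (\<lambda>a. Ub *v a)"

text \<open>Data model of Assumption 1 (columns indexed 0..M2-1; the first n_o are outliers).
  A sample \<omega> gives the column d_j = \<omega> j.\<close>
definition data_measure :: "nat \<Rightarrow> nat \<Rightarrow> real^'r^'m \<Rightarrow> (nat \<Rightarrow> real^'m) measure" where
  "data_measure no ni Ub = PiM {..<no + ni}
      (\<lambda>j. if j < no then (uniform_sphere :: (real^'m) measure) else uniform_subspace_sphere Ub)"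

definition l1_obj :: "(nat \<Rightarrow> real^'m) \<Rightarrow> nat \<Rightarrow> real^'m \<Rightarrow> real" where
  "l1_obj \<omega> M2 c = (\<Sum>i<M2. \<bar>c \<bullet> \<omega> i\<bar>)"

definition is_opt_point :: "(nat \<Rightarrow> real^'m) \<Rightarrow> nat \<Rightarrow> nat \<Rightarrow> real^'m \<Rightarrow> bool" where
  "is_opt_point \<omega> M2 j c \<longleftrightarrow>
     c \<bullet> \<omega> j = 1 \<and> (\<forall>c'. c' \<bullet> \<omega> j = 1 \<longrightarrow> l1_obj \<omega> M2 c \<le> l1_obj \<omega> M2 c')"

definition innovation_value :: "(nat \<Rightarrow> real^'m) \<Rightarrow> nat \<Rightarrow> real^'m \<Rightarrow> real" where
  "innovation_value \<omega> M2 c = 1 / l1_obj \<omega> M2 c"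

definition chi :: "nat \<Rightarrow> (nat \<Rightarrow> real^'m) \<Rightarrow> real" where
  "chi no c = Max ((\<lambda>j. norm (c j)) ` {..<no})"

definition nz' :: "nat \<Rightarrow> (nat \<Rightarrow> real^'m) \<Rightarrow> (nat \<Rightarrow> real^'m) \<Rightarrow> nat" where
  "nz' no \<omega> c = Max ((\<lambda>j. card {i. i < no \<and> c j \<bullet> \<omega> i = 0}) ` {..<no})"

text \<open>Exact subspace recovery: for every ordering of the columns by increasing Innovation
  Value (ties broken arbitrarily), adding columns in that order until their span has
  dimension r yields exactly the subspace Uset.\<close>
definition recovers :: "(nat \<Rightarrow> real^'m) \<Rightarrow> nat \<Rightarrow> (nat \<Rightarrow> real) \<Rightarrow> nat \<Rightarrow> (real^'m) set \<Rightarrow> bool" where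
  "recovers \<omega> M2 IV r Uset \<longleftrightarrow>
     (\<forall>\<sigma>. bij_betw \<sigma> {..<M2} {..<M2} \<and> (\<forall>k l. k \<le> l \<and> l < M2 \<longrightarrow> IV (\<sigma> k) \<le> IV (\<sigma> l)) \<longrightarrow>
        (\<exists>k\<le>M2. dim (span ((\<lambda>t. \<omega> (\<sigma> t)) ` {..<k})) = r
               \<and> (\<forall>k'<k. dim (span ((\<lambda>t. \<omega> (\<sigma> t)) ` {..<k'})) < r)
               \<and> span ((\<lambda>t. \<omega> (\<sigma> t)) ` {..<k}) = Uset))"

definition calA :: "real \<Rightarrow> real \<Rightarrow> real \<Rightarrow> real" where
  "calA ni r \<delta> = sqrt (1 / (2 * pi)) * ni / sqrt r - sqrt ni - sqrt (ni * ln (1 / \<delta>) / (2 * r - 2))"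

definition sqrt_c_delta :: "real \<Rightarrow> real \<Rightarrow> real \<Rightarrow> real \<Rightarrow> real" where
  "sqrt_c_delta M1 r no \<delta> = 3 * max 1 (max (sqrt (8 * M1 * pi / ((M1 - 1) * r)))
                                          (sqrt (8 * M1 * ln (no / \<delta>) / ((M1 - 1) * r))))"

definition c_delta :: "real \<Rightarrow> real \<Rightarrow> real \<Rightarrow> real \<Rightarrow> real" where
  "c_delta M1 r no \<delta> = (sqrt_c_delta M1 r no \<delta>)\<^sup>2"

definition sqrt_c''_delta :: "real \<Rightarrow> real \<Rightarrow> real \<Rightarrow> real" where
  "sqrt_c''_delta M1 no \<delta> = 3 * max 1 (max (sqrt (8 * M1 * pi / (M1 - 1)))
                                          (sqrt (16 * M1 * ln (no / \<delta>) / (M1 - 1))))"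

definition c''_delta :: "real \<Rightarrow> real \<Rightarrow> real \<Rightarrow> real" where
  "c''_delta M1 no \<delta> = (sqrt_c''_delta M1 no \<delta>)\<^sup>2"

definition eta_delta :: "real \<Rightarrow> real \<Rightarrow> real \<Rightarrow> real" where
  "eta_delta M1 no \<delta> = max (4 / 3 * ln (2 * M1 / \<delta>)) (sqrt (4 * (no / M1) * ln (2 * M1 / \<delta>)))"

definition cond_i :: "real \<Rightarrow> real \<Rightarrow> real \<Rightarrow> real \<Rightarrow> real \<Rightarrow> real \<Rightarrow> bool" where
  "cond_i M1 r no ni \<delta> nz \<longleftrightarrow>
     (let cd = c_delta M1 r no \<delta> in
      calA ni r \<delta> > 2 * nz * sqrt (cd * r / M1) + 2 * sqrt (no * cd * r * ln (no / \<delta>) / M1))"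

definition cond_ii :: "real \<Rightarrow> real \<Rightarrow> real \<Rightarrow> real \<Rightarrow> real \<Rightarrow> real \<Rightarrow> bool" where
  "cond_ii M1 r no ni \<delta> nz \<longleftrightarrow>
     (let cd = c_delta M1 r no \<delta>; cd'' = c''_delta M1 no \<delta>; \<eta> = eta_delta M1 no \<delta> in
      calA ni r \<delta> >
        (no / M1 + sqrt (4 * no / M1)
         + sqrt (2 * no * ln (1 / \<delta>) / ((M1 - 1) * M1))
         + sqrt (no * cd'' * ln (no / \<delta>) / M1\<^sup>2)
         + nz * sqrt (cd'' / M1\<^sup>2)
         + sqrt (no * ln (no / \<delta>) / M1\<^sup>2 + \<eta> * ln (no / \<delta>) / M1))
        * sqrt (4 * M1 * cd / (M1 - cd * r)))"

definition cond_iii :: "real \<Rightarrow> real \<Rightarrow> real \<Rightarrow> real \<Rightarrow> real \<Rightarrow> real \<Rightarrow> bool" where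
  "cond_iii M1 r no ni \<delta> ch \<longleftrightarrow>
      calA ni r \<delta> > ch * no / sqrt M1 + 2 * sqrt no * (1 + sqrt ch)
                     + 2 * sqrt (2 * ch * no * ln (1 / \<delta>) / (M1 - 1))"

end

theory Submission
  imports Defs
begin

text \<open>
  An inlier pays at least the infimum over unit vectors \<open>w\<close> of the sum of
  \<open>\<bar>w \<bullet> U\<^sup>T a\<bar>\<close> over all inliers \<open>a\<close>, because the constraint of its program forces the optimal point to
  have a component of norm at least 1 in the subspace. An outlier \<open>b\<close> pays at most the cost of the
  multiple of its residual \<open>b - U U\<^sup>T b\<close>, which kills every inlier and hence costs at most the
  supremum over unit vectors \<open>u\<close> of the sum of \<open>\<bar>u \<bullet> b'\<bar>\<close> over all outliers, divided by the norm
  of the residual. The hypothesis \<open>M > c_delta r\<close> makes that norm at least \<open>sqrt 3 / 2\<close> for all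
  outliers simultaneously.

  The supremum is controlled by a union bound over signs, the infimum by an \<open>\<epsilon>\<close>-net and a Chernoff
  bound. Both rest on comparing the sphere with a Gaussian vector \<open>g\<close>, whose norm and direction are
  independent: \<open>E \<psi> (v \<bullet> g)\<close> dominates the spherical average by Jensen's inequality in the radius.
  Once the inliers come first in the ordering, positivity of the infimum says that they span.
\<close>

section \<open>The standard Gaussian measure\<close>

text \<open>The room in the argument comes from \<open>calA\<close>: its leading coefficient
  \<open>sqrt (1 / (2 * pi))\<close> is half the Gaussian mean of \<open>\<bar>t\<bar>\<close>, so
  the sum over the inliers can be shown to exceed \<open>calA\<close> by a constant factor in all
  directions. This surplus pays for two losses on the outlier side: the union over all sign
  patterns, which puts \<open>2 * sqrt (2 * ln 2)\<close> into the estimate where condition (iii)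
  offers the coefficient 1 for \<open>no / sqrt M\<close>, and the residual norm, which is only
  known to be at least \<open>sqrt 3 / 2\<close>. The selection \<open>c\<close> of optimal points
  is an arbitrary function of the sample, so sets described through \<open>c\<close> or
  \<open>chi\<close> need not be events. All probabilistic statements therefore concern the columns
  alone and hold for every direction at once. Only then does \<open>c\<close> enter, sample by
  sample, through feasibility and optimality; feasibility for a unit column also yields
  \<open>chi \<ge> 1\<close>, which turns condition (iii) into a bound free of
  \<open>c\<close>.\<close>

definition gauss :: "'a::euclidean_space measure" where
  "gauss = density lborel (\<lambda>x. ennreal (\<Prod>b\<in>Basis. std_normal_density (x \<bullet> b)))"

lemma sets_gauss [simp, measurable_cong]: "sets gauss = sets borel"
  by (simp add: gauss_def)

lemma space_gauss [simp]: "space gauss = UNIV"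
  by (simp add: gauss_def)

lemma nn_integral_gauss_prod:
  fixes f :: "'a::euclidean_space \<Rightarrow> real \<Rightarrow> ennreal"
  assumes [measurable]: "\<And>b. b \<in> Basis \<Longrightarrow> f b \<in> borel_measurable borel"
  shows "(\<integral>\<^sup>+x. (\<Prod>b\<in>Basis. f b (x \<bullet> b)) \<partial>gauss) =
    (\<Prod>b\<in>Basis. \<integral>\<^sup>+t. f b t * std_normal_density t \<partial>lborel)"
proof -
  have "(\<integral>\<^sup>+x. (\<Prod>b\<in>Basis. f b (x \<bullet> b)) \<partial>gauss) =
     (\<integral>\<^sup>+x. (\<Prod>b\<in>Basis. (\<lambda>t. f b t * std_normal_density t) (x \<bullet> b)) \<partial>lborel)"
    unfolding gauss_def
    by (subst nn_integral_density)
       (auto simp: prod.distrib prod_ennreal[symmetric] mult.commute intro!: nn_integral_cong)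
  also have "\<dots> = (\<Prod>b\<in>Basis. \<integral>\<^sup>+t. f b t * std_normal_density t \<partial>lborel)"
    by (rule nn_integral_lborel_prod) auto
  finally show ?thesis .
qed

lemma nn_integral_std_normal: "(\<integral>\<^sup>+t. ennreal (std_normal_density t) \<partial>lborel) = 1"
  using prob_space.emeasure_space_1[OF prob_space_normal_density[of 1 0]]
  by (simp add: emeasure_density)

lemma prob_space_gauss: "prob_space gauss"
proof
  show "emeasure (gauss :: 'a measure) (space gauss) = 1"
    using nn_integral_gauss_prod[of "\<lambda>(_::'a) _. 1"]
    by (simp add: nn_integral_std_normal)
qed

lemma emeasure_gauss_box:
  assumes "\<And>b. b \<in> Basis \<Longrightarrow> A b \<in> sets borel"
  shows "emeasure gauss {x::'a::euclidean_space. \<forall>b\<in>Basis. x \<bullet> b \<in> A b} =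
    (\<Prod>b\<in>Basis. emeasure (density lborel std_normal_density) (A b))"
proof -
  have [measurable]: "b \<in> Basis \<Longrightarrow> A b \<in> sets borel" for b
    by fact
  have m: "{x::'a. \<forall>b\<in>Basis. x \<bullet> b \<in> A b} \<in> sets borel"
    by measurable
  have "emeasure gauss {x::'a. \<forall>b\<in>Basis. x \<bullet> b \<in> A b} =
      (\<integral>\<^sup>+x. indicator {x::'a. \<forall>b\<in>Basis. x \<bullet> b \<in> A b} x \<partial>gauss)"
    using m by simp
  also have "\<dots> = (\<integral>\<^sup>+(x::'a). (\<Prod>b\<in>Basis. indicator (A b) (x \<bullet> b)) \<partial>gauss)"
    by (intro nn_integral_cong) (auto simp: indicator_def intro!: prod.neutral)
  also have "\<dots> = (\<Prod>b\<in>Basis. emeasure (density lborel std_normal_density) (A b))"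
    by (subst nn_integral_gauss_prod)
       (auto simp: emeasure_density mult.commute intro!: prod.cong)
  finally show ?thesis .
qed

lemma distr_gauss_component:
  assumes c: "c \<in> Basis"
  shows "distr gauss borel (\<lambda>x::'a::euclidean_space. x \<bullet> c) = density lborel std_normal_density"
proof (rule measure_eqI)
  fix B assume B: "B \<in> sets (distr gauss borel (\<lambda>x::'a. x \<bullet> c))"
  interpret N: prob_space "density lborel (\<lambda>x. ennreal (std_normal_density x))"
    by (rule prob_space_normal_density) simp
  have "emeasure (distr gauss borel (\<lambda>x::'a. x \<bullet> c)) B =
      emeasure gauss {x::'a. \<forall>b\<in>Basis. x \<bullet> b \<in> (if b = c then B else UNIV)}"
    using B c by (subst emeasure_distr) (auto intro!: arg_cong2[where f=emeasure] split: if_splits)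
  also have "\<dots> = (\<Prod>b\<in>Basis. emeasure (density lborel std_normal_density) (if b = c then B else UNIV))"
    using B by (subst emeasure_gauss_box) auto
  also have "\<dots> = (\<Prod>b\<in>Basis. if b = c then emeasure (density lborel std_normal_density) B else 1)"
    using N.emeasure_space_1 by (intro prod.cong) auto
  also have "\<dots> = emeasure (density lborel std_normal_density) B"
    using c by simp
  finally show "emeasure (distr gauss borel (\<lambda>x::'a. x \<bullet> c)) B = emeasure (density lborel std_normal_density) B" .
qed simp

text \<open>Independence amounts to the joint law of the coordinates being the product of their
  laws. The two are compared on boxes, where \<open>emeasure_gauss_box\<close> factorises.\<close>

lemma indep_gauss: "prob_space.indep_vars (gauss :: 'a::euclidean_space measure) (\<lambda>_. borel) (\<lambda>b x. x \<bullet> b) Basis"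
proof -
  interpret G: prob_space "gauss :: 'a measure" by (rule prob_space_gauss)
  interpret N: prob_space "density lborel (\<lambda>x. ennreal (std_normal_density x))"
    by (rule prob_space_normal_density) simp
  interpret P: product_prob_space "\<lambda>_::'a. density lborel (\<lambda>x. ennreal (std_normal_density x))" Basis
    by unfold_locales
  have "distr (gauss::'a measure) (Pi\<^sub>M Basis (\<lambda>_. borel)) (\<lambda>x. \<lambda>b\<in>Basis. x \<bullet> b) =
      Pi\<^sub>M Basis (\<lambda>_. density lborel std_normal_density)"
  proof (rule P.PiM_eqI)
    fix A :: "'a \<Rightarrow> real set"
    assume A: "\<And>i. i \<in> Basis \<Longrightarrow> A i \<in> sets (density lborel std_normal_density)"
    have "(\<lambda>x::'a. \<lambda>b\<in>Basis. x \<bullet> b) -` Pi\<^sub>E Basis A = {x. \<forall>b\<in>Basis. x \<bullet> b \<in> A b}"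
      by (auto simp: PiE_iff)
    then show "emeasure (distr (gauss::'a measure) (Pi\<^sub>M Basis (\<lambda>_. borel)) (\<lambda>x. \<lambda>b\<in>Basis. x \<bullet> b)) (Pi\<^sub>E Basis A) =
      (\<Prod>i\<in>Basis. emeasure (density lborel std_normal_density) (A i))"
      using A by (subst emeasure_distr)
        (auto intro!: emeasure_gauss_box sets_PiM_I_finite measurable_restrict)
  qed (auto intro!: sets_PiM_cong)
  also have "\<dots> = Pi\<^sub>M Basis (\<lambda>b. distr (gauss::'a measure) borel (\<lambda>x. x \<bullet> b))"
    by (intro PiM_cong refl) (simp add: distr_gauss_component)
  finally show ?thesis
    by (subst G.indep_vars_iff_distr_eq_PiM') auto
qed

lemma distr_gauss_inner:
  fixes v :: "'a::euclidean_space"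
  assumes v: "norm v = 1"
  shows "distr gauss borel (\<lambda>x. v \<bullet> x) = density lborel std_normal_density"
proof -
  interpret G: prob_space "gauss :: 'a measure" by (rule prob_space_gauss)
  \<comment> \<open>Coordinates with coefficient 0 are dropped: each summand must be normal with a
    positive standard deviation.\<close>
  define I where "I = {b\<in>Basis. v \<bullet> b \<noteq> 0}"
  have sum: "v \<bullet> x = (\<Sum>b\<in>I. (v \<bullet> b) * (x \<bullet> b))" for x
    unfolding I_def by (subst euclidean_inner) (auto intro!: sum.mono_neutral_right)
  have vv: "(\<Sum>b\<in>I. (v \<bullet> b)\<^sup>2) = 1"
    using sum[of v] v by (simp add: power2_eq_square dot_square_norm)
  have "I \<noteq> {}" using vv by auto
  have ind: "G.indep_vars (\<lambda>_. borel) (\<lambda>b x. (v \<bullet> b) * (x \<bullet> b)) I"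
    by (rule G.indep_vars_compose2[OF G.indep_vars_subset[OF indep_gauss]]) (auto simp: I_def)
  have "distributed gauss lborel (\<lambda>x. (v \<bullet> b) * (x \<bullet> b)) (normal_density 0 \<bar>v \<bullet> b\<bar>)" if "b \<in> I" for b
  proof -
    have "distributed gauss lborel (\<lambda>x. x \<bullet> b) std_normal_density"
      unfolding distributed_def using that distr_gauss_component[of b]
      by (auto simp: I_def cong: distr_cong)
    from G.normal_density_affine[OF this, of "v \<bullet> b" 0] that show ?thesis
      by (simp add: I_def)
  qed
  then have "distributed gauss lborel (\<lambda>x. \<Sum>b\<in>I. (v \<bullet> b) * (x \<bullet> b))
      (normal_density (\<Sum>b\<in>I. 0) (sqrt (\<Sum>b\<in>I. \<bar>v \<bullet> b\<bar>\<^sup>2)))"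
    using ind \<open>I \<noteq> {}\<close> by (intro G.sum_indep_normal) (auto simp: I_def)
  then show ?thesis
    by (simp add: vv sum[symmetric] distributed_def cong: distr_cong)
qed

lemma nn_integral_gauss_inner:
  fixes v :: "'a::euclidean_space"
  assumes "norm v = 1" and [measurable]: "f \<in> borel_measurable borel"
  shows "(\<integral>\<^sup>+x. f (v \<bullet> x) \<partial>gauss) = (\<integral>\<^sup>+t. ennreal (std_normal_density t) * f t \<partial>lborel)"
proof -
  have "(\<integral>\<^sup>+x. f (v \<bullet> x) \<partial>gauss) = (\<integral>\<^sup>+t. f t \<partial>distr gauss borel (\<lambda>x. v \<bullet> x))"
    by (subst nn_integral_distr) auto
  also have "\<dots> = (\<integral>\<^sup>+t. ennreal (std_normal_density t) * f t \<partial>lborel)"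
    unfolding distr_gauss_inner[OF assms(1)] by (subst nn_integral_density) auto
  finally show ?thesis .
qed

text \<open>Completing the square shifts the mean of each coordinate. Read from right to left, the
  identity linearises the exponential of a squared norm, which is how
  \<open>norm_tail_of_mgf\<close> uses it.\<close>

lemma nn_integral_gauss_exp_inner:
  fixes v :: "'a::euclidean_space"
  shows "(\<integral>\<^sup>+x. ennreal (exp (v \<bullet> x)) \<partial>gauss) = ennreal (exp ((norm v)\<^sup>2 / 2))"
proof -
  have 1: "(\<integral>\<^sup>+t. ennreal (exp (c * t)) * std_normal_density t \<partial>lborel) = ennreal (exp (c\<^sup>2 / 2))" for c :: real
  proof -
    have "exp (c * t) * std_normal_density t = exp (c\<^sup>2 / 2) * normal_density c 1 t" for t
      by (simp add: normal_density_def exp_add[symmetric] power2_eq_square algebra_simps diff_divide_distrib add_divide_distrib)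
    then have "(\<integral>\<^sup>+t. ennreal (exp (c * t)) * std_normal_density t \<partial>lborel) =
        (\<integral>\<^sup>+t. ennreal (exp (c\<^sup>2 / 2)) * ennreal (normal_density c 1 t) \<partial>lborel)"
      by (simp add: ennreal_mult'[symmetric])
    also have "\<dots> = ennreal (exp (c\<^sup>2 / 2))"
      using prob_space.emeasure_space_1[OF prob_space_normal_density[of 1 c]]
      by (subst nn_integral_cmult) (auto simp: emeasure_density)
    finally show ?thesis .
  qed
  have "(\<integral>\<^sup>+x. ennreal (exp (v \<bullet> x)) \<partial>gauss) =
      (\<integral>\<^sup>+x. (\<Prod>b\<in>Basis. ennreal (exp ((v \<bullet> b) * (x \<bullet> b)))) \<partial>gauss)"
    by (subst euclidean_inner) (simp add: exp_sum prod_ennreal)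
  also have "\<dots> = (\<Prod>b\<in>Basis. ennreal (exp ((v \<bullet> b)\<^sup>2 / 2)))"
    by (subst nn_integral_gauss_prod) (auto simp: 1)
  also have "\<dots> = ennreal (exp ((norm v)\<^sup>2 / 2))"
    unfolding power2_norm_eq_inner[of v] 
    by (subst (2) euclidean_inner) (simp add: exp_sum prod_ennreal power2_eq_square sum_divide_distrib)
  finally show ?thesis .
qed

text \<open>The integrand turns each coordinate into a centred normal of variance
  \<open>1 / (1 - y)\<close>, whence the restriction on \<open>y\<close>; the constant is the ratio
  of the normalisations.\<close>

lemma nn_integral_gauss_exp_norm:
  assumes y: "y < 1"
  shows "(\<integral>\<^sup>+(x::'a::euclidean_space). ennreal (exp (y * (norm x)\<^sup>2 / 2)) \<partial>gauss) =
    ennreal ((1 / sqrt (1 - y)) ^ DIM('a))"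
proof -
  have 1: "(\<integral>\<^sup>+t. ennreal (exp (y * t\<^sup>2 / 2)) * std_normal_density t \<partial>lborel) = ennreal (1 / sqrt (1 - y))"
  proof -
    let ?s = "1 / sqrt (1 - y)"
    have s: "?s > 0" using y by simp
    have "exp (y * t\<^sup>2 / 2) * std_normal_density t = ?s * normal_density 0 ?s t" for t
    proof -
      have "- t\<^sup>2 / (2 * ?s\<^sup>2) = y * t\<^sup>2 / 2 + - t\<^sup>2 / 2"
        using y by (simp add: field_simps)
      moreover have "sqrt (2 * pi * ?s\<^sup>2) = sqrt (2 * pi) * ?s"
        using s by (simp add: real_sqrt_mult real_sqrt_divide)
      ultimately show ?thesis
        using s by (simp add: normal_density_def mult_exp_exp)
    qed
    then have "(\<integral>\<^sup>+t. ennreal (exp (y * t\<^sup>2 / 2)) * std_normal_density t \<partial>lborel) =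
        (\<integral>\<^sup>+t. ennreal ?s * ennreal (normal_density 0 ?s t) \<partial>lborel)"
      using s by (simp only: ennreal_mult'[symmetric] exp_ge_zero less_imp_le)
    also have "\<dots> = ennreal ?s"
      using prob_space.emeasure_space_1[OF prob_space_normal_density[OF s, of 0]]
      by (subst nn_integral_cmult) (auto simp: emeasure_density)
    finally show ?thesis .
  qed
  have e: "(norm x)\<^sup>2 = (\<Sum>b\<in>Basis. (x \<bullet> b)\<^sup>2)" for x :: 'a
    unfolding power2_norm_eq_inner by (subst euclidean_inner) (simp add: power2_eq_square)
  have "(\<integral>\<^sup>+(x::'a). ennreal (exp (y * (norm x)\<^sup>2 / 2)) \<partial>gauss) =
      (\<integral>\<^sup>+(x::'a). (\<Prod>b\<in>Basis. ennreal (exp (y * (x \<bullet> b)\<^sup>2 / 2))) \<partial>gauss)"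
    by (simp add: e exp_sum prod_ennreal sum_distrib_left sum_divide_distrib)
  also have "\<dots> = ennreal (1 / sqrt (1 - y)) ^ DIM('a)"
    by (subst nn_integral_gauss_prod) (auto simp: 1)
  also have "\<dots> = ennreal ((1 / sqrt (1 - y)) ^ DIM('a))"
    using y by (simp add: ennreal_power)
  finally show ?thesis .
qed

section \<open>Polar decomposition\<close>

lemma sets_uniform_sphere [simp, measurable_cong]: "sets uniform_sphere = sets borel"
  by (simp add: uniform_sphere_def)

lemma space_uniform_sphere [simp]: "space uniform_sphere = UNIV"
  by (simp add: uniform_sphere_def)

lemma emeasure_lborel_ball_pos:
  "emeasure lborel (ball (0::'a::euclidean_space) 1) \<noteq> 0" "emeasure lborel (ball (0::'a::euclidean_space) 1) \<noteq> \<infinity>"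
  using unit_ball_vol_pos[of "real DIM('a)", OF of_nat_0_le_iff, THEN less_imp_neq, THEN not_sym] by (auto simp: emeasure_ball)

lemma prob_space_uniform_sphere: "prob_space (uniform_sphere :: 'a::euclidean_space measure)"
  unfolding uniform_sphere_def
  by (intro prob_space.prob_space_distr prob_space_uniform_measure emeasure_lborel_ball_pos) auto

definition radial :: "'a::euclidean_space \<Rightarrow> 'a" where "radial x = x /\<^sub>R norm x"

lemma measurable_radial [measurable]: "radial \<in> borel_measurable borel"
  unfolding radial_def by measurable

lemma radial_scaleR: "c > 0 \<Longrightarrow> radial (c *\<^sub>R x) = radial x"
  by (simp add: radial_def)

lemma norm_radial: "x \<noteq> 0 \<Longrightarrow> norm (radial x) = 1"
  by (simp add: radial_def)

lemma emeasure_uniform_sphere: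
  assumes "B \<in> sets borel"
  shows "emeasure (uniform_sphere :: 'a::euclidean_space measure) B =
    emeasure lborel {x::'a. norm x < 1 \<and> radial x \<in> B} / emeasure lborel (ball (0::'a) 1)"
proof -
  have [measurable]: "B \<in> sets borel" by fact
  have "emeasure (uniform_sphere :: 'a measure) B =
      emeasure (uniform_measure lborel (ball (0::'a) 1)) {x. radial x \<in> B}"
    unfolding uniform_sphere_def radial_def[symmetric]
    using assms by (subst emeasure_distr) (auto simp: vimage_def)
  also have "\<dots> = emeasure lborel (ball 0 1 \<inter> {x::'a. radial x \<in> B}) / emeasure lborel (ball (0::'a) 1)"
    by (rule emeasure_uniform_measure) auto
  also have "ball 0 1 \<inter> {x::'a. radial x \<in> B} = {x. norm x < 1 \<and> radial x \<in> B}"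
    by auto
  finally show ?thesis .
qed

lemma emeasure_cone_scale:
  assumes s: "s > 0" and [measurable]: "B \<in> sets borel"
  shows "emeasure lborel {x::'a::euclidean_space. norm x < s \<and> radial x \<in> B} =
    ennreal (s ^ DIM('a)) * emeasure lborel {x::'a. norm x < 1 \<and> radial x \<in> B}"
proof -
  let ?A = "{x::'a. norm x < s \<and> radial x \<in> B}"
  have A: "?A \<in> sets borel" by measurable
  have "emeasure lborel ?A =
      emeasure (density (distr lborel borel (\<lambda>x::'a. 0 + s *\<^sub>R x)) (\<lambda>_. \<bar>s\<bar>^DIM('a))) ?A"
    using lborel_affine[of s "0::'a"] s by simp
  also have "\<dots> = ennreal (s ^ DIM('a)) * emeasure (distr lborel borel (\<lambda>x::'a. 0 + s *\<^sub>R x)) ?A"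
    using A s by (subst emeasure_density_const) (auto simp: ennreal_power)
  also have "emeasure (distr lborel borel (\<lambda>x::'a. 0 + s *\<^sub>R x)) ?A =
      emeasure lborel {x::'a. norm x < 1 \<and> radial x \<in> B}"
    using A s by (subst emeasure_distr) (auto simp: radial_scaleR intro!: arg_cong2[where f=emeasure])
  finally show ?thesis .
qed

text \<open>For fixed \<open>B\<close> both sides are measures in \<open>A\<close>, namely
  \<open>N1\<close> and \<open>N2\<close>. Homogeneity (\<open>emeasure_cone_scale\<close>) makes
  them agree on the half-lines \<open>{..<s}\<close>, which are closed under intersection, generate
  the Borel sets and have finite measure.\<close>

lemma emeasure_cone:
  assumes [measurable]: "A \<in> sets borel" "B \<in> sets borel"
  shows "emeasure lborel {x::'a::euclidean_space. norm x \<in> A \<and> radial x \<in> B} =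
    emeasure lborel {x::'a. norm x \<in> A} * emeasure uniform_sphere B"
proof -
  define N1 where "N1 = distr (density lborel (indicator {x::'a. radial x \<in> B})) (borel :: real measure) norm"
  define N2 where "N2 = density (distr lborel (borel :: real measure) (norm :: 'a \<Rightarrow> real)) (\<lambda>_. emeasure (uniform_sphere::'a measure) B)"
  have N1: "emeasure N1 C = emeasure lborel {x::'a. norm x \<in> C \<and> radial x \<in> B}" if [measurable]: "C \<in> sets borel" for C
  proof -
    have m: "{x::'a. radial x \<in> B} \<in> sets borel" "norm -` C \<in> sets (borel :: 'a measure)"
      "{x::'a. norm x \<in> C \<and> radial x \<in> B} \<in> sets borel"
      using measurable_sets[of norm "borel :: 'a measure" borel C] that by auto
    have "emeasure N1 C = (\<integral>\<^sup>+x. indicator {x::'a. norm x \<in> C \<and> radial x \<in> B} x \<partial>lborel)"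
      unfolding N1_def using m
      by (auto simp: emeasure_distr emeasure_density indicator_def intro!: nn_integral_cong)
    then show ?thesis using m by simp
  qed
  have N2: "emeasure N2 C = emeasure lborel {x::'a. norm x \<in> C} * emeasure (uniform_sphere::'a measure) B"
    if [measurable]: "C \<in> sets borel" for C
    unfolding N2_def using that
    by (subst emeasure_density_const) (auto simp: emeasure_distr vimage_def mult.commute)
  let ?E = "range (\<lambda>s::real. {..<s})"
  have bd: "emeasure lborel {x::'a. norm x < s} \<noteq> \<infinity>" for s
  proof -
    have "{x::'a. norm x < s} = ball 0 s" by auto
    then show ?thesis using emeasure_bounded_finite[of "ball (0::'a) s"] by simp
  qed
  have "N1 = N2"
  proof (rule measure_eqI_generator_eq[where E="?E" and \<Omega>=UNIV and A="\<lambda>i. {..<real i}"])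
    show "Int_stable ?E"
    proof (rule Int_stableI)
      fix X Y :: "real set" assume "X \<in> ?E" "Y \<in> ?E"
      then obtain a b where "X = {..<a}" "Y = {..<b}" by auto
      then have "X \<inter> Y = {..<min a b}" by auto
      then show "X \<inter> Y \<in> ?E" by blast
    qed
    show "sets N1 = sigma_sets UNIV ?E" "sets N2 = sigma_sets UNIV ?E"
      by (simp_all add: N1_def N2_def borel_Iio)
    show "(\<Union>i. {..<real i}) = UNIV"
      using reals_Archimedean2 by auto
    show "emeasure N1 {..<real i} \<noteq> \<infinity>" for i
    proof -
      have "emeasure N1 {..<real i} \<le> emeasure lborel {x::'a. norm x < real i}"
        by (subst N1) (auto intro!: emeasure_mono)
      with bd[of "real i"] show ?thesis by (auto simp: top_unique)
    qed
    show "emeasure N1 X = emeasure N2 X" if "X \<in> ?E" for X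
    proof -
      from that obtain s where X: "X = {..<s}" by auto
      show ?thesis
      proof (cases "s > 0")
        case True
        have "emeasure N1 X = ennreal (s ^ DIM('a)) * emeasure lborel {x::'a. norm x < 1 \<and> radial x \<in> B}"
          using True emeasure_cone_scale[of s B] by (simp add: X N1)
        moreover have "emeasure N2 X = ennreal (s ^ DIM('a)) * emeasure lborel (ball (0::'a) 1) *
           (emeasure lborel {x::'a. norm x < 1 \<and> radial x \<in> B} / emeasure lborel (ball (0::'a) 1))"
        proof -
          have "{x::'a. norm x < 1} = ball 0 1" by auto
          then show ?thesis
            using True emeasure_cone_scale[of s "UNIV :: 'a set"]
            by (simp add: X N2 emeasure_uniform_sphere)
        qed
        moreover have "emeasure lborel (ball (0::'a) 1) \<noteq> 0" "emeasure lborel (ball (0::'a) 1) \<noteq> \<infinity>"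
          by (rule emeasure_lborel_ball_pos)+
        moreover have "a * b * (c / b) = a * c" if "b \<noteq> 0" "b \<noteq> \<infinity>" for a b c :: ennreal
        proof -
          have "b * (c / b) = c"
            using that by (simp add: ennreal_times_divide mult.commute[of b] ennreal_mult_divide_eq)
          then show ?thesis by (simp only: mult.assoc)
        qed
        ultimately show ?thesis by presburger
      next
        case False
        then have "\<not> norm (x::'a) < s" for x
          using norm_ge_zero[of x] by linarith
        then show ?thesis by (simp add: X N1 N2)
      qed
    qed
  qed auto
  then show ?thesis using N1[of A] N2[of A] by simp
qed

text \<open>The radial factor stays the push-forward of Lebesgue measure under the norm, so no
  surface area and no radial density has to be computed.\<close>

lemma polar_lborel:
  "distr lborel (borel \<Otimes>\<^sub>M borel) (\<lambda>x::'a::euclidean_space. (norm x, radial x)) =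
    distr lborel borel (norm :: 'a \<Rightarrow> real) \<Otimes>\<^sub>M uniform_sphere"
proof (rule pair_measure_eqI[symmetric])
  interpret S: prob_space "uniform_sphere :: 'a measure" by (rule prob_space_uniform_sphere)
  show "sigma_finite_measure (uniform_sphere :: 'a measure)" ..
  show "sigma_finite_measure (distr lborel borel (norm :: 'a \<Rightarrow> real))"
  proof
    have "emeasure (distr lborel borel (norm :: 'a \<Rightarrow> real)) {..<real i} \<noteq> \<infinity>" for i
    proof -
      have "(norm :: 'a \<Rightarrow> real) -` {..<real i} = ball 0 (real i)" by auto
      then show ?thesis using emeasure_bounded_finite[of "ball (0::'a) (real i)"] by (simp add: emeasure_distr)
    qed
    then show "\<exists>A. countable A \<and> A \<subseteq> sets (distr lborel borel (norm :: 'a \<Rightarrow> real)) \<and>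
        \<Union> A = space (distr lborel borel (norm :: 'a \<Rightarrow> real)) \<and>
        (\<forall>a\<in>A. emeasure (distr lborel borel (norm :: 'a \<Rightarrow> real)) a \<noteq> \<infinity>)"
      by (intro exI[of _ "range (\<lambda>i::nat. {..<real i})"]) (use reals_Archimedean2 in auto)
  qed
  fix A B assume "A \<in> sets (distr lborel borel (norm :: 'a \<Rightarrow> real))" "B \<in> sets (uniform_sphere :: 'a measure)"
  then have [measurable]: "A \<in> sets borel" "B \<in> sets borel" by auto
  have [measurable]: "A \<times> B \<in> sets (borel \<Otimes>\<^sub>M borel)" by simp
  have "emeasure (distr lborel (borel \<Otimes>\<^sub>M borel) (\<lambda>x::'a. (norm x, radial x))) (A \<times> B) =
     emeasure lborel {x::'a. norm x \<in> A \<and> radial x \<in> B}"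
    by (subst emeasure_distr) (auto intro!: arg_cong2[where f=emeasure])
  then show "emeasure (distr lborel borel (norm :: 'a \<Rightarrow> real)) A * emeasure uniform_sphere B =
    emeasure (distr lborel (borel \<Otimes>\<^sub>M borel) (\<lambda>x::'a. (norm x, radial x))) (A \<times> B)"
    by (simp add: emeasure_cone emeasure_distr vimage_def)
qed simp

text \<open>The link between the two faces of the Gaussian: the product form gives independent
  coordinates, the dependence on the norm alone gives an independent direction.\<close>

lemma gauss_density_norm:
  "(\<Prod>b\<in>Basis. std_normal_density (x \<bullet> b)) = (1 / sqrt (2 * pi)) ^ DIM('a) * exp (- (norm x)\<^sup>2 / 2)"
  for x :: "'a::euclidean_space"
proof -
  have "(norm x)\<^sup>2 = (\<Sum>b\<in>Basis. (x \<bullet> b)\<^sup>2)"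
    unfolding power2_norm_eq_inner by (subst euclidean_inner) (simp add: power2_eq_square)
  then show ?thesis
    by (simp only: std_normal_density_def prod.distrib prod_constant exp_sum[symmetric] finite_Basis
        sum_negf sum_divide_distrib[symmetric])
qed

text \<open>In polar coordinates the density is a function \<open>h\<close> of the radius and merges
  with \<open>H\<close>, leaving the directional factor untouched. The unknown radial integral is
  then read back as a Gaussian integral.\<close>

lemma nn_integral_gauss_polar:
  fixes k :: "'a::euclidean_space \<Rightarrow> ennreal"
  assumes [measurable]: "H \<in> borel_measurable borel" "k \<in> borel_measurable borel"
  shows "(\<integral>\<^sup>+x. H (norm x) * k (radial x) \<partial>gauss) =
    (\<integral>\<^sup>+(x::'a). H (norm x) \<partial>gauss) * (\<integral>\<^sup>+u. k u \<partial>uniform_sphere)"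
proof -
  interpret S: prob_space "uniform_sphere :: 'a measure" by (rule prob_space_uniform_sphere)
  define h where "h s = ennreal ((1 / sqrt (2 * pi)) ^ DIM('a) * exp (- s\<^sup>2 / 2))" for s :: real
  have [measurable]: "h \<in> borel_measurable borel" unfolding h_def by measurable
  have g: "(\<integral>\<^sup>+x. f x \<partial>gauss) = (\<integral>\<^sup>+(x::'a). h (norm x) * f x \<partial>lborel)" if "f \<in> borel_measurable borel" for f
    unfolding gauss_def gauss_density_norm h_def using that by (subst nn_integral_density) auto
  have "(\<integral>\<^sup>+x. H (norm x) * k (radial x) \<partial>gauss) =
     (\<integral>\<^sup>+z. (h (fst z) * H (fst z)) * k (snd z) \<partial>distr lborel (borel \<Otimes>\<^sub>M borel) (\<lambda>x::'a. (norm x, radial x)))"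
    by (subst g, measurable, subst nn_integral_distr) (auto simp: mult.assoc)
  also have "\<dots> = (\<integral>\<^sup>+s. \<integral>\<^sup>+u. (h s * H s) * k u \<partial>uniform_sphere \<partial>distr lborel borel (norm :: 'a \<Rightarrow> real))"
    unfolding polar_lborel by (subst S.nn_integral_fst[symmetric]) auto
  also have "\<dots> = (\<integral>\<^sup>+s. h s * H s \<partial>distr lborel borel (norm :: 'a \<Rightarrow> real)) * (\<integral>\<^sup>+u. k u \<partial>uniform_sphere)"
    by (subst nn_integral_cmult, measurable, subst nn_integral_multc) auto
  also have "(\<integral>\<^sup>+s. h s * H s \<partial>distr lborel borel (norm :: 'a \<Rightarrow> real)) = (\<integral>\<^sup>+(x::'a). H (norm x) \<partial>gauss)"
    by (subst g, measurable, subst nn_integral_distr) auto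
  finally show ?thesis .
qed

section \<open>Comparison of the sphere with the Gaussian\<close>

lemma gauss_norm_sq: "(\<integral>\<^sup>+(x::'a::euclidean_space). ennreal ((norm x)\<^sup>2) \<partial>gauss) = ennreal DIM('a)"
proof -
  have 1: "(\<integral>\<^sup>+x. ennreal ((x \<bullet> b)\<^sup>2) \<partial>gauss) = 1" if "b \<in> Basis" for b :: 'a
  proof -
    have "(\<integral>\<^sup>+x. ennreal ((x \<bullet> b)\<^sup>2) \<partial>gauss) = (\<integral>\<^sup>+t. ennreal (std_normal_density t) * ennreal (t\<^sup>2) \<partial>lborel)"
      using nn_integral_gauss_inner[of b "\<lambda>t. ennreal (t\<^sup>2)"] that by (simp add: inner_commute)
    also have "\<dots> = (\<integral>\<^sup>+t. ennreal (std_normal_density t * t ^ (2 * 1)) \<partial>lborel)"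
      by (simp add: ennreal_mult'[symmetric])
    also have "\<dots> = 1"
      using std_normal_moment_even[of 1]
      by (subst nn_integral_eq_integral) (auto simp: has_bochner_integral_iff fact_numeral)
    finally show ?thesis .
  qed
  have "(norm x)\<^sup>2 = (\<Sum>b\<in>Basis. (x \<bullet> b)\<^sup>2)" for x :: 'a
    unfolding power2_norm_eq_inner by (subst euclidean_inner) (simp add: power2_eq_square)
  then have "(\<integral>\<^sup>+(x::'a). ennreal ((norm x)\<^sup>2) \<partial>gauss) = (\<integral>\<^sup>+(x::'a). (\<Sum>b\<in>Basis. ennreal ((x \<bullet> b)\<^sup>2)) \<partial>gauss)"
    by (simp add: sum_ennreal)
  also have "\<dots> = (\<Sum>b\<in>(Basis::'a set). 1)"
    by (subst nn_integral_sum) (auto intro!: sum.cong simp: 1)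
  finally show ?thesis by (simp add: ennreal_of_nat_eq_real_of_nat)
qed

lemma nn_integral_uniform_sphere:
  fixes k :: "'a::euclidean_space \<Rightarrow> ennreal"
  assumes "k \<in> borel_measurable borel"
  shows "(\<integral>\<^sup>+u. k u \<partial>uniform_sphere) = (\<integral>\<^sup>+x. k (radial x) \<partial>gauss)"
proof -
  interpret G: prob_space "gauss :: 'a measure" by (rule prob_space_gauss)
  show ?thesis
    using nn_integral_gauss_polar[of "\<lambda>_. 1" k] assms G.emeasure_space_1 by simp
qed

text \<open>The weight has Gaussian mean 1 and is independent of the direction. This is what makes
  the linear term vanish when Jensen's inequality is applied in the squared radius.\<close>

lemma nn_integral_norm_sq_radial:
  fixes k :: "'a::euclidean_space \<Rightarrow> ennreal"
  assumes "k \<in> borel_measurable borel"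
  shows "(\<integral>\<^sup>+x. ennreal ((norm x)\<^sup>2 / DIM('a)) * k (radial x) \<partial>gauss) = (\<integral>\<^sup>+x. k (radial x) \<partial>gauss)"
proof -
  have "(\<integral>\<^sup>+(x::'a). ennreal ((norm x)\<^sup>2 / DIM('a)) \<partial>gauss) = (\<integral>\<^sup>+(x::'a). ennreal (1 / DIM('a)) * ennreal ((norm x)\<^sup>2) \<partial>gauss)"
    by (simp add: ennreal_mult'[symmetric])
  also have "\<dots> = 1"
    by (subst nn_integral_cmult) (simp_all add: gauss_norm_sq ennreal_mult'[symmetric])
  finally show ?thesis
    using nn_integral_gauss_polar[of "\<lambda>s. ennreal (s\<^sup>2 / DIM('a))" k] assms
    by (simp add: nn_integral_uniform_sphere)
qed

text \<open>Write \<open>v \<bullet> x\<close> as \<open>R * w\<close> with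
  \<open>R = norm x / sqrt d\<close>, so that the square of \<open>R\<close> has mean 1 given the
  direction. Hypothesis \<open>le\<close> says that \<psi> lies above its tangent at 1 as a function
  of the squared radius, with slope \<kappa> - \<nu>. The slope is split into two nonnegative parts,
  one on each side, because the integrals take values in the extended nonnegative reals;
  \<open>bound\<close> makes the added terms finite so that they can be cancelled.\<close>

lemma uniform_sphere_le_gauss:
  fixes v :: "'a::euclidean_space" and \<psi> \<kappa> \<nu> :: "real \<Rightarrow> real"
  assumes [measurable]: "\<psi> \<in> borel_measurable borel" "\<kappa> \<in> borel_measurable borel" "\<nu> \<in> borel_measurable borel"
    and nonneg: "\<And>w. \<psi> w \<ge> 0" "\<And>w. \<kappa> w \<ge> 0" "\<And>w. \<nu> w \<ge> 0"
    and le: "\<And>w R. R \<ge> 0 \<Longrightarrow> \<psi> w + R\<^sup>2 * \<kappa> w + \<nu> w \<le> \<psi> (R * w) + \<kappa> w + R\<^sup>2 * \<nu> w"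
    and bound: "\<And>w. \<bar>w\<bar> \<le> sqrt DIM('a) * norm v \<Longrightarrow> \<kappa> w + \<nu> w \<le> K"
  shows "(\<integral>\<^sup>+u. ennreal (\<psi> (sqrt DIM('a) * (v \<bullet> u))) \<partial>uniform_sphere) \<le> (\<integral>\<^sup>+x. ennreal (\<psi> (v \<bullet> x)) \<partial>gauss)"
proof -
  interpret G: prob_space "gauss :: 'a measure" by (rule prob_space_gauss)
  define d where "d = real DIM('a)"
  have d: "d > 0" by (simp add: d_def)
  define w where "w x = sqrt d * (v \<bullet> radial x)" for x :: 'a
  have [measurable]: "w \<in> borel_measurable borel" unfolding w_def by measurable
  have wb: "\<bar>w x\<bar> \<le> sqrt d * norm v" for x
  proof -
    have "norm (radial x) \<le> 1" by (cases "x = 0") (auto simp: norm_radial, simp add: radial_def)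
    then have "\<bar>v \<bullet> radial x\<bar> \<le> norm v"
      using Cauchy_Schwarz_ineq2[of v "radial x"] mult_left_mono[of "norm (radial x)" 1 "norm v"] by simp
    then show ?thesis using d by (simp add: w_def abs_mult)
  qed
  have pw: "ennreal (\<psi> (w x)) + ennreal ((norm x)\<^sup>2 / d) * ennreal (\<kappa> (w x)) + ennreal (\<nu> (w x)) \<le>
      ennreal (\<psi> (v \<bullet> x)) + ennreal (\<kappa> (w x)) + ennreal ((norm x)\<^sup>2 / d) * ennreal (\<nu> (w x))" for x
  proof -
    have "(norm x / sqrt d) * w x = v \<bullet> x"
      using d by (cases "x = 0") (auto simp: w_def radial_def)
    then have "\<psi> (w x) + (norm x / sqrt d)\<^sup>2 * \<kappa> (w x) + \<nu> (w x) \<le>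
       \<psi> (v \<bullet> x) + \<kappa> (w x) + (norm x / sqrt d)\<^sup>2 * \<nu> (w x)"
      using le[of "norm x / sqrt d" "w x"] d by simp
    then show ?thesis
      using d nonneg by (simp add: ennreal_mult'[symmetric] ennreal_plus[symmetric] power_divide del: ennreal_plus)
  qed
  have fin: "(\<integral>\<^sup>+x. ennreal (\<kappa> (w x)) + ennreal (\<nu> (w x)) \<partial>gauss) \<noteq> \<infinity>"
  proof -
    have "ennreal (\<kappa> (w x)) + ennreal (\<nu> (w x)) \<le> ennreal K" for x
      using nonneg bound[of "w x"] wb[of x]
      by (simp add: ennreal_plus[symmetric] d_def del: ennreal_plus) (rule ennreal_leI, simp)
    then have "(\<integral>\<^sup>+x. ennreal (\<kappa> (w x)) + ennreal (\<nu> (w x)) \<partial>gauss) \<le> (\<integral>\<^sup>+(x::'a). ennreal K \<partial>gauss)"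
      by (intro nn_integral_mono)
    also have "\<dots> < \<infinity>"
      using G.emeasure_space_1 by simp
    finally show ?thesis by simp
  qed
  have k: "(\<integral>\<^sup>+x. ennreal ((norm x)\<^sup>2 / d) * ennreal (g (w x)) \<partial>gauss) = (\<integral>\<^sup>+x. ennreal (g (w x)) \<partial>gauss)"
    if [measurable]: "g \<in> borel_measurable borel" for g :: "real \<Rightarrow> real"
    using nn_integral_norm_sq_radial[of "\<lambda>u. ennreal (g (sqrt d * (v \<bullet> u)))"]
    by (simp add: d_def w_def)
  have "(\<integral>\<^sup>+x. ennreal (\<psi> (w x)) \<partial>gauss) + (\<integral>\<^sup>+x. ennreal (\<kappa> (w x)) + ennreal (\<nu> (w x)) \<partial>gauss) =
      (\<integral>\<^sup>+x. ennreal (\<psi> (w x)) + ennreal ((norm x)\<^sup>2 / d) * ennreal (\<kappa> (w x)) + ennreal (\<nu> (w x)) \<partial>gauss)"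
    by (simp add: nn_integral_add k add.assoc)
  also have "\<dots> \<le> (\<integral>\<^sup>+x. ennreal (\<psi> (v \<bullet> x)) + ennreal (\<kappa> (w x)) + ennreal ((norm x)\<^sup>2 / d) * ennreal (\<nu> (w x)) \<partial>gauss)"
    by (intro nn_integral_mono pw)
  also have "\<dots> = (\<integral>\<^sup>+x. ennreal (\<psi> (v \<bullet> x)) \<partial>gauss) + (\<integral>\<^sup>+x. ennreal (\<kappa> (w x)) + ennreal (\<nu> (w x)) \<partial>gauss)"
    by (simp add: nn_integral_add k add.assoc)
  finally have "(\<integral>\<^sup>+x. ennreal (\<psi> (w x)) \<partial>gauss) \<le> (\<integral>\<^sup>+x. ennreal (\<psi> (v \<bullet> x)) \<partial>gauss)"
    using fin by (simp add: ennreal_add_left_cancel_le add.commute[of "nn_integral gauss _" "\<integral>\<^sup>+x. ennreal (\<kappa> (w x)) + ennreal (\<nu> (w x)) \<partial>gauss"] top_unique)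
  then show ?thesis
    by (subst nn_integral_uniform_sphere) (auto simp: w_def d_def)
qed

section \<open>Tangent inequalities in the squared radius\<close>

lemma sinh_mult_le:
  fixes w R :: real
  assumes "w \<ge> 0" "0 \<le> R" "R \<le> 1"
  shows "sinh (R * w) \<le> R * sinh w"
proof -
  have "convex_on {0..} (sinh :: real \<Rightarrow> real)"
    by (rule f''_ge0_imp_convex[where f'=cosh and f''=sinh])
       (auto intro!: derivative_eq_intros)
  from convex_onD[OF this, of R 0 w] show ?thesis
    using assms by simp
qed

text \<open>This is convexity of \<open>cosh (sqrt s * w)\<close> in \<open>s\<close>, at the point
  \<open>s = 1\<close> with slope \<open>w * sinh w / 2\<close>. The difference of the two sides, as
  a function \<open>h\<close> of \<open>R\<close>, has derivative
  \<open>w * (sinh (R * w) - R * sinh w)\<close>, which changes sign at 1 by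
  \<open>sinh_mult_le\<close>.\<close>

lemma cosh_tangent:
  fixes w R :: real
  assumes R: "R \<ge> 0"
  shows "cosh w + R\<^sup>2 * (w * sinh w / 2) \<le> cosh (R * w) + w * sinh w / 2"
proof -
  have *: "cosh w + R\<^sup>2 * (w * sinh w / 2) \<le> cosh (R * w) + w * sinh w / 2" if w: "w \<ge> 0" for w :: real
  proof -
    define h where "h R = cosh (R * w) - cosh w - (R\<^sup>2 - 1) * (w * sinh w / 2)" for R
    have h1: "h 1 = 0" by (simp add: h_def)
    have D: "(h has_real_derivative (w * (sinh (R * w) - R * sinh w))) (at R)" for R
      unfolding h_def by (auto intro!: derivative_eq_intros simp: algebra_simps)
    have "h R \<ge> h 1"
    proof (cases "R \<le> 1")
      case True
      show ?thesis
      proof (rule DERIV_nonpos_imp_nonincreasing[OF True])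
        fix x assume "R \<le> x" "x \<le> 1"
        then have "w * (sinh (x * w) - x * sinh w) \<le> 0"
          using sinh_mult_le[of w x] w R by (simp add: mult_nonneg_nonpos)
        with D show "\<exists>y. DERIV h x :> y \<and> y \<le> 0" by blast
      qed
    next
      case False
      show ?thesis
      proof (rule DERIV_nonneg_imp_nondecreasing[where f=h and a=1 and b=R])
        show "1 \<le> R" using False by simp
        fix x assume x: "1 \<le> x" "x \<le> R"
        \<comment> \<open>Beyond 1 the same convexity bound is used for the reciprocal
          scale.\<close>
        have "sinh (1 / x * (x * w)) \<le> 1 / x * sinh (x * w)"
          using x w by (intro sinh_mult_le) auto
        then have "w * (sinh (x * w) - x * sinh w) \<ge> 0"
          using x w by (intro mult_nonneg_nonneg) (simp_all add: field_simps)
        with D show "\<exists>y. DERIV h x :> y \<and> y \<ge> 0" by blast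
      qed
    qed
    then have "0 \<le> cosh (R * w) - cosh w - (R\<^sup>2 - 1) * (w * sinh w / 2)"
      by (simp only: h1) (simp only: h_def)
    also have "\<dots> = cosh (R * w) + w * sinh w / 2 - (cosh w + R\<^sup>2 * (w * sinh w / 2))"
      by (simp add: left_diff_distrib diff_divide_distrib)
    finally show ?thesis by simp
  qed
  show ?thesis
    using *[of w] *[of "-w"] by (cases "w \<ge> 0") auto
qed

text \<open>Two tangents in a row: \<open>exp\<close> lies above its tangent at \<open>- w\<close>,
  and \<open>1 - R\<close> exceeds half of \<open>1 - R\<^sup>2\<close> by half of
  \<open>(R - 1)\<^sup>2\<close>. The slope in the squared radius is negative here, so its term
  stands on the opposite side from the one in \<open>cosh_tangent\<close>.\<close>

lemma exp_neg_tangent: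
  fixes w R :: real
  assumes R: "R \<ge> 0" and w: "w \<ge> 0"
  shows "exp (- w) + w * exp (- w) / 2 \<le> exp (- (R * w)) + R\<^sup>2 * (w * exp (- w) / 2)"
proof -
  have "exp (- w) * (1 + (w - R * w)) \<le> exp (- w) * exp (w - R * w)"
    by (intro mult_left_mono exp_ge_add_one_self) auto
  also have "\<dots> = exp (- (R * w))"
    by (simp add: exp_add[symmetric])
  finally have 1: "exp (- w) * (1 + (w - R * w)) \<le> exp (- (R * w))" .
  have "0 \<le> exp (- w) * w * (R - 1)\<^sup>2 / 2"
    using w by simp
  also have "\<dots> = exp (- w) * (1 + (w - R * w)) - exp (- w) * (1 + w * (1 - R\<^sup>2) / 2)"
    by (simp add: power2_eq_square field_simps)
  finally have "exp (- w) * (1 + w * (1 - R\<^sup>2) / 2) \<le> exp (- w) * (1 + (w - R * w))"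
    by linarith
  with 1 have "exp (- w) * (1 + w * (1 - R\<^sup>2) / 2) \<le> exp (- (R * w))" by linarith
  moreover have "exp (- w) * (1 + w * (1 - R\<^sup>2) / 2) =
      exp (- w) + w * exp (- w) / 2 - R\<^sup>2 * (w * exp (- w) / 2)"
    by (simp add: field_simps)
  ultimately show ?thesis by linarith
qed

section \<open>Laplace transforms on the sphere\<close>

lemma uniform_sphere_minus:
  "distr uniform_sphere borel uminus = (uniform_sphere :: 'a::euclidean_space measure)"
proof (rule measure_eqI)
  fix B assume "B \<in> sets (distr (uniform_sphere :: 'a measure) borel uminus)"
  then have [measurable]: "B \<in> sets borel" by simp
  have B': "uminus -` B \<in> sets (borel :: 'a measure)"
    using measurable_sets[of uminus borel borel B] by simp
  let ?A = "{x::'a. norm x < 1 \<and> radial x \<in> B}"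
  have "emeasure lborel ?A = emeasure (distr lborel borel (\<lambda>x::'a. 0 + (-1) *\<^sub>R x)) ?A"
    using lborel_affine[of "-1" "0::'a"] by (simp add: density_1)
  also have "\<dots> = emeasure lborel {x::'a. norm x < 1 \<and> radial x \<in> uminus -` B}"
    by (subst emeasure_distr) (auto simp: radial_def intro!: arg_cong2[where f=emeasure])
  finally show "emeasure (distr (uniform_sphere :: 'a measure) borel uminus) B = emeasure uniform_sphere B"
    using B' by (simp add: emeasure_distr emeasure_uniform_sphere)
qed simp

text \<open>The tangent inequality in the squared radius fails for \<open>exp\<close> at small
  positive arguments, but holds for \<open>cosh\<close>. Symmetry of the sphere allows the
  replacement, and \<open>v'\<close> absorbs the factor \<open>sqrt d\<close>; the result is the
  transform of a Gaussian vector with variance \<open>1 / d\<close> in each direction.\<close>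

lemma uniform_sphere_mgf:
  fixes v :: "'a::euclidean_space"
  shows "(\<integral>\<^sup>+u. ennreal (exp (v \<bullet> u)) \<partial>uniform_sphere) \<le> ennreal (exp ((norm v)\<^sup>2 / (2 * DIM('a))))"
proof -
  define d where "d = real DIM('a)"
  have d: "d > 0" by (simp add: d_def)
  define v' where "v' = v /\<^sub>R sqrt d"
  have v': "sqrt d * (v' \<bullet> u) = v \<bullet> u" for u using d by (simp add: v'_def)
  have "(\<integral>\<^sup>+u. ennreal (exp (v \<bullet> u)) \<partial>uniform_sphere) =
      (\<integral>\<^sup>+u. ennreal (exp (v \<bullet> u)) \<partial>distr uniform_sphere borel uminus)"
    by (simp add: uniform_sphere_minus)
  also have "\<dots> = (\<integral>\<^sup>+u. ennreal (exp (- (v \<bullet> u))) \<partial>uniform_sphere)"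
    by (subst nn_integral_distr) auto
  finally have sym: "(\<integral>\<^sup>+u. ennreal (exp (v \<bullet> u)) \<partial>uniform_sphere) =
      (\<integral>\<^sup>+u. ennreal (exp (- (v \<bullet> u))) \<partial>uniform_sphere)" .
  have "2 * (\<integral>\<^sup>+u. ennreal (exp (v \<bullet> u)) \<partial>uniform_sphere) =
      (\<integral>\<^sup>+u. ennreal (exp (v \<bullet> u)) + ennreal (exp (- (v \<bullet> u))) \<partial>uniform_sphere)"
    by (subst nn_integral_add) (auto simp: sym[symmetric] mult_2)
  also have "\<dots> = (\<integral>\<^sup>+u. 2 * ennreal (cosh (v \<bullet> u)) \<partial>uniform_sphere)"
    by (intro nn_integral_cong)
       (auto simp: cosh_def ennreal_plus[symmetric] ennreal_mult'[symmetric] simp flip: ennreal_numeral simp del: ennreal_plus)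
  also have "\<dots> = 2 * (\<integral>\<^sup>+u. ennreal (cosh (sqrt d * (v' \<bullet> u))) \<partial>uniform_sphere)"
    by (subst nn_integral_cmult) (auto simp: v' cosh_def)
  also have "\<dots> \<le> 2 * (\<integral>\<^sup>+u. ennreal (cosh (v' \<bullet> u)) \<partial>gauss)"
    unfolding d_def
  proof (intro mult_left_mono uniform_sphere_le_gauss[where \<kappa>="\<lambda>w. w * sinh w / 2" and \<nu>="\<lambda>_. 0"])
    let ?c = "sqrt DIM('a) * norm v'"
    show "w * sinh w / 2 + 0 \<le> ?c * sinh ?c / 2" if w: "\<bar>w\<bar> \<le> ?c" for w
    proof -
      have "w * sinh w = \<bar>w\<bar> * sinh \<bar>w\<bar>" by (simp add: abs_if)
      also have "\<dots> \<le> ?c * sinh ?c"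
        using w by (intro mult_mono) (simp_all del: sinh_real_abs)
      finally show ?thesis by simp
    qed
    show "0 \<le> w * sinh w / 2" for w :: real
      by (simp add: zero_le_mult_iff linear)
    show "cosh w + R\<^sup>2 * (w * sinh w / 2) + 0 \<le> cosh (R * w) + w * sinh w / 2 + R\<^sup>2 * 0" if "R \<ge> 0" for w R :: real
      using cosh_tangent[OF that, of w] by simp
  qed (auto simp: cosh_def sinh_def)
  also have "\<dots> = (\<integral>\<^sup>+u. 2 * ennreal (cosh (v' \<bullet> u)) \<partial>gauss)"
    by (subst nn_integral_cmult) (auto simp: cosh_def)
  also have "\<dots> = (\<integral>\<^sup>+u. ennreal (exp (v' \<bullet> u)) + ennreal (exp (- v' \<bullet> u)) \<partial>gauss)"
    by (intro nn_integral_cong)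
       (auto simp: cosh_def ennreal_plus[symmetric] ennreal_mult'[symmetric] simp flip: ennreal_numeral simp del: ennreal_plus)
  also have "\<dots> = 2 * ennreal (exp ((norm v')\<^sup>2 / 2))"
    by (subst nn_integral_add) (auto simp only: nn_integral_gauss_exp_inner norm_minus_cancel mult_2, measurable)
  finally have "(\<integral>\<^sup>+u. ennreal (exp (v \<bullet> u)) \<partial>uniform_sphere) \<le> ennreal (exp ((norm v')\<^sup>2 / 2))"
    by (subst (asm) ennreal_mult_le_mult_iff) auto
  also have "(norm v')\<^sup>2 = (norm v)\<^sup>2 / d"
    using d by (simp add: v'_def power_mult_distrib power_divide field_simps)
  finally show ?thesis by (simp add: d_def mult.commute)
qed

lemma uniform_sphere_exp_neg_abs:
  fixes v :: "'a::euclidean_space"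
  assumes mu: "\<mu> \<ge> 0" and v: "norm v = 1"
  shows "(\<integral>\<^sup>+u. ennreal (exp (- (\<mu> * sqrt DIM('a) * \<bar>v \<bullet> u\<bar>))) \<partial>uniform_sphere) \<le>
    (\<integral>\<^sup>+t. ennreal (std_normal_density t * exp (- (\<mu> * \<bar>t\<bar>))) \<partial>lborel)"
proof -
  have "(\<integral>\<^sup>+u. ennreal (exp (- (\<mu> * \<bar>sqrt DIM('a) * (v \<bullet> u)\<bar>))) \<partial>uniform_sphere) \<le>
    (\<integral>\<^sup>+x. ennreal (exp (- (\<mu> * \<bar>v \<bullet> x\<bar>))) \<partial>gauss)"
  \<comment> \<open>The slope is negative, so it is carried by \<nu> alone. The bound 1/2 comes from
    \<open>x * exp (- x) \<le> 1\<close>.\<close>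
  proof (rule uniform_sphere_le_gauss[where \<kappa>="\<lambda>_. 0" and \<nu>="\<lambda>w. \<mu> * \<bar>w\<bar> * exp (- (\<mu> * \<bar>w\<bar>)) / 2" and K="1/2"])
    show "exp (- (\<mu> * \<bar>w\<bar>)) + R\<^sup>2 * 0 + \<mu> * \<bar>w\<bar> * exp (- (\<mu> * \<bar>w\<bar>)) / 2 \<le>
        exp (- (\<mu> * \<bar>R * w\<bar>)) + 0 + R\<^sup>2 * (\<mu> * \<bar>w\<bar> * exp (- (\<mu> * \<bar>w\<bar>)) / 2)" if "R \<ge> 0" for w R
      using exp_neg_tangent[of R "\<mu> * \<bar>w\<bar>"] that mu by (simp add: abs_mult mult_ac)
    show "0 + \<mu> * \<bar>w\<bar> * exp (- (\<mu> * \<bar>w\<bar>)) / 2 \<le> 1/2" for w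
    proof -
      have "\<mu> * \<bar>w\<bar> \<le> exp (\<mu> * \<bar>w\<bar>)"
        using exp_ge_add_one_self[of "\<mu> * \<bar>w\<bar>"] by linarith
      then show ?thesis by (simp add: exp_minus field_simps)
    qed
  qed (use mu in auto)
  also have "\<dots> = (\<integral>\<^sup>+t. ennreal (std_normal_density t) * ennreal (exp (- (\<mu> * \<bar>t\<bar>))) \<partial>lborel)"
    by (rule nn_integral_gauss_inner[OF v, of "\<lambda>t. ennreal (exp (- (\<mu> * \<bar>t\<bar>)))"]) auto
  finally show ?thesis
    by (simp add: abs_mult ennreal_mult' mult_ac)
qed

section \<open>Laplace transform of the half-normal distribution and norm tails\<close>

text \<open>The Lagrange remainder of order 4 is nonnegative.\<close>

lemma exp_neg_ge_cubic:
  fixes z :: real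
  assumes "z \<ge> 0"
  shows "1 - z + z\<^sup>2 / 2 - z ^ 3 / 6 \<le> exp (- z)"
proof -
  obtain t where "exp (- z) = (\<Sum>m<4. ((- z) ^ m) / fact m) + (exp t / fact 4) * (- z) ^ 4"
    using Maclaurin_exp_le[of "- z" 4] by blast
  then show ?thesis
    using assms by (simp add: eval_nat_numeral fact_numeral)
qed

text \<open>Completing the square gives \<open>exp (\<mu>\<^sup>2 / 2)\<close> times the normal
  probability of lying outside \<open>{-\<mu>..\<mu>}\<close>. The additive form avoids subtraction
  of extended reals, and the remaining integral over a bounded interval can be estimated by
  polynomials.\<close>

lemma half_normal_laplace:
  fixes \<mu> :: real
  assumes mu: "\<mu> \<ge> 0"
  shows "(\<integral>\<^sup>+t. ennreal (std_normal_density t * exp (- (\<mu> * \<bar>t\<bar>))) \<partial>lborel) +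
      ennreal (exp (\<mu>\<^sup>2 / 2)) * (\<integral>\<^sup>+t. ennreal (std_normal_density t) * indicator {-\<mu>..\<mu>} t \<partial>lborel) =
      ennreal (exp (\<mu>\<^sup>2 / 2))"
proof -
  let ?\<phi> = "\<lambda>t. ennreal (std_normal_density t)"
  have [simp]: "std_normal_density (- t) = std_normal_density t" for t
    by (simp add: std_normal_density_def)
  have "std_normal_density t * exp (- (\<mu> * \<bar>t\<bar>)) = exp (\<mu>\<^sup>2 / 2) * std_normal_density (\<bar>t\<bar> + \<mu>)" for t
    by (simp add: std_normal_density_def mult_exp_exp power2_sum field_simps)
  then have "(\<integral>\<^sup>+t. ennreal (std_normal_density t * exp (- (\<mu> * \<bar>t\<bar>))) \<partial>lborel) =
      ennreal (exp (\<mu>\<^sup>2 / 2)) * (\<integral>\<^sup>+t. ?\<phi> (\<bar>t\<bar> + \<mu>) \<partial>lborel)"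
    by (simp add: ennreal_mult' nn_integral_cmult)
  moreover have "(\<integral>\<^sup>+t. ?\<phi> (\<bar>t\<bar> + \<mu>) \<partial>lborel) =
     (\<integral>\<^sup>+t. ?\<phi> t * indicator {\<mu>..} t \<partial>lborel) + (\<integral>\<^sup>+t. ?\<phi> t * indicator {..< -\<mu>} t \<partial>lborel)"
  proof -
    have "(\<integral>\<^sup>+t. ?\<phi> (\<bar>t\<bar> + \<mu>) \<partial>lborel) =
        (\<integral>\<^sup>+t. ?\<phi> (\<mu> + 1 * t) * indicator {\<mu>..} (\<mu> + 1 * t) +
              ?\<phi> (- \<mu> + 1 * t) * indicator {..< -\<mu>} (- \<mu> + 1 * t) \<partial>lborel)"
    proof (intro nn_integral_cong)
      fix t :: real
      have "std_normal_density (t - \<mu>) = std_normal_density (\<mu> - t)"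
        by (simp add: std_normal_density_def power2_commute)
      then show "?\<phi> (\<bar>t\<bar> + \<mu>) = ?\<phi> (\<mu> + 1 * t) * indicator {\<mu>..} (\<mu> + 1 * t) +
              ?\<phi> (- \<mu> + 1 * t) * indicator {..< -\<mu>} (- \<mu> + 1 * t)"
        by (cases "t \<ge> 0") (auto simp: indicator_def add.commute)
    qed
    also have "\<dots> = (\<integral>\<^sup>+t. ?\<phi> (\<mu> + 1 * t) * indicator {\<mu>..} (\<mu> + 1 * t) \<partial>lborel) +
              (\<integral>\<^sup>+t. ?\<phi> (- \<mu> + 1 * t) * indicator {..< -\<mu>} (- \<mu> + 1 * t) \<partial>lborel)"
      by (subst nn_integral_add) auto
    finally show ?thesis
      using nn_integral_real_affine[of "\<lambda>t. ?\<phi> t * indicator {\<mu>..} t" 1 \<mu>]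
        nn_integral_real_affine[of "\<lambda>t. ?\<phi> t * indicator {..< -\<mu>} t" 1 "- \<mu>"]
      by simp
  qed
  moreover have "(\<integral>\<^sup>+t. ?\<phi> t * indicator {\<mu>..} t \<partial>lborel) + (\<integral>\<^sup>+t. ?\<phi> t * indicator {..< -\<mu>} t \<partial>lborel) +
      (\<integral>\<^sup>+t. ?\<phi> t * indicator {-\<mu>..\<mu>} t \<partial>lborel) = 1"
  proof -
    have "(\<integral>\<^sup>+t. ?\<phi> t * indicator {\<mu>..} t \<partial>lborel) + (\<integral>\<^sup>+t. ?\<phi> t * indicator {..< -\<mu>} t \<partial>lborel) +
      (\<integral>\<^sup>+t. ?\<phi> t * indicator {-\<mu>..\<mu>} t \<partial>lborel) =
      (\<integral>\<^sup>+t. ?\<phi> t * indicator {\<mu>..} t + ?\<phi> t * indicator {..< -\<mu>} t + ?\<phi> t * indicator {-\<mu>..\<mu>} t \<partial>lborel)"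
      by (simp add: nn_integral_add)
    \<comment> \<open>The three sets cover the line and overlap only in the point \<mu>, so the
      integrands agree almost everywhere.\<close>
    also have "\<dots> = (\<integral>\<^sup>+t. ?\<phi> t \<partial>lborel)"
      using AE_lborel_singleton[of \<mu>] mu
      by (intro nn_integral_cong_AE) (auto simp: indicator_def elim!: eventually_mono)
    finally show ?thesis by (simp add: nn_integral_std_normal)
  qed
  ultimately show ?thesis
    by (simp add: distrib_left[symmetric])
qed

text \<open>The normal mass of \<open>{- 21/20..21/20}\<close> is at least 705/1000, which leaves
  295/1000 times \<open>exp (?\<mu>\<^sup>2 / 2)\<close> in
  \<open>half_normal_laplace\<close>.\<close>

lemma half_normal_laplace_bound:
  "(\<integral>\<^sup>+t. ennreal (std_normal_density t * exp (- (21/20 * \<bar>t\<bar>))) \<partial>lborel) \<le> ennreal (exp (- (133/200)))"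
proof -
  let ?\<mu> = "21/20 :: real"
  let ?I = "\<integral>\<^sup>+t. ennreal (std_normal_density t * exp (- (?\<mu> * \<bar>t\<bar>))) \<partial>lborel"
  \<comment> \<open>The cubic Taylor minorant of \<open>exp (- z)\<close> at
    \<open>z = t\<^sup>2 / 2\<close>, times a lower bound for
    \<open>1 / sqrt (2 * pi)\<close>.\<close>
  define p :: "real \<Rightarrow> real" where "p t = 3989/10000 * (1 - t\<^sup>2 / 2 + t ^ 4 / 8 - t ^ 6 / 48)" for t
  have z: "1 / sqrt (2 * pi) \<ge> 3989/10000"
  proof -
    have "(3989/10000)\<^sup>2 * (2 * pi) \<le> (1::real)"
      using pi_approx(2) by (simp add: power2_eq_square)
    then have "3989/10000 * sqrt (2 * pi) \<le> (1::real)"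
      using real_le_rsqrt real_sqrt_le_1_iff[of "(3989/10000)\<^sup>2 * (2 * pi)"]
      by (simp add: real_sqrt_mult)
    then show ?thesis by (simp add: field_simps)
  qed
  have p: "0 \<le> p t" "p t \<le> std_normal_density t" if "t \<in> {- ?\<mu>..?\<mu>}" for t
  proof -
    define z where "z = t\<^sup>2 / 2"
    have z0: "0 \<le> z" by (simp add: z_def)
    have "\<bar>t\<bar> \<le> ?\<mu>" using that by auto
    then have "t\<^sup>2 \<le> ?\<mu>\<^sup>2" by (simp add: abs_le_square_iff[symmetric])
    then have z1: "z \<le> 1" by (simp add: z_def power2_eq_square)
    have e: "1 - t\<^sup>2 / 2 + t ^ 4 / 8 - t ^ 6 / 48 = 1 - z + z\<^sup>2 / 2 - z ^ 3 / 6"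
      by (simp add: z_def power_divide flip: power_mult)
    have "z ^ 3 \<le> z\<^sup>2" using z0 z1 by (simp add: power_decreasing)
    then have nn: "0 \<le> 1 - z + z\<^sup>2 / 2 - z ^ 3 / 6" using z1 zero_le_power2[of z] by linarith
    then show "0 \<le> p t" by (simp add: p_def e)
    have "3989/10000 * (1 - z + z\<^sup>2 / 2 - z ^ 3 / 6) \<le> (1 / sqrt (2 * pi)) * exp (- z)"
      using exp_neg_ge_cubic[OF z0] nn z by (intro mult_mono) auto
    then show "p t \<le> std_normal_density t"
      by (simp add: p_def e std_normal_density_def z_def)
  qed
  \<comment> \<open>884/1000 is a lower bound for the primitive of the bracket in \<open>p\<close>
    at 21/20; the factor 2 is due to symmetry.\<close>
  have "ennreal (705/1000) \<le> ennreal (3989/10000 * (2 * 884/1000))"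
    by (intro ennreal_leI) simp
  also have "\<dots> \<le> (\<integral>\<^sup>+t. ennreal (p t) * indicator {- ?\<mu>..?\<mu>} t \<partial>lborel)"
  proof -
    let ?P = "\<lambda>t::real. 3989/10000 * (t - t ^ 3 / 6 + t ^ 5 / 40 - t ^ 7 / 336)"
    have "(\<integral>\<^sup>+t. ennreal (p t) * indicator {- ?\<mu>..?\<mu>} t \<partial>lborel) = ?P ?\<mu> - ?P (- ?\<mu>)"
    proof (rule nn_integral_FTC_Icc)
      show "p \<in> borel_measurable borel" unfolding p_def by measurable
      show "(?P has_real_derivative p t) (at t)" for t
        unfolding p_def
        by (auto intro!: derivative_eq_intros simp: field_simps)
    qed (use p in auto)
    also have "\<dots> \<ge> ennreal (3989/10000 * (2 * 884/1000))"
      by (intro ennreal_leI) (simp add: power_divide)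
    finally show ?thesis .
  qed
  also have "\<dots> \<le> (\<integral>\<^sup>+t. ennreal (std_normal_density t) * indicator {- ?\<mu>..?\<mu>} t \<partial>lborel)"
    using p by (intro nn_integral_mono) (auto simp: indicator_def intro!: ennreal_leI)
  finally have J: "ennreal (705/1000) \<le> (\<integral>\<^sup>+t. ennreal (std_normal_density t) * indicator {- ?\<mu>..?\<mu>} t \<partial>lborel)" .
  have "?I + ennreal (exp (?\<mu>\<^sup>2 / 2)) * ennreal (705/1000) \<le>
      ?I + ennreal (exp (?\<mu>\<^sup>2 / 2)) * (\<integral>\<^sup>+t. ennreal (std_normal_density t) * indicator {- ?\<mu>..?\<mu>} t \<partial>lborel)"
    using J by (intro add_mono mult_mono) auto
  also have "\<dots> = ennreal (exp (?\<mu>\<^sup>2 / 2))"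
    by (rule half_normal_laplace) simp
  finally have "?I + ennreal (exp (?\<mu>\<^sup>2 / 2) * (705/1000)) \<le> ennreal (exp (?\<mu>\<^sup>2 / 2) * (295/1000)) + ennreal (exp (?\<mu>\<^sup>2 / 2) * (705/1000))"
    by (simp add: ennreal_mult'[symmetric] ennreal_plus[symmetric] del: ennreal_plus)
  then have "?I \<le> ennreal (exp (?\<mu>\<^sup>2 / 2) * (295/1000))"
    by (simp add: ennreal_add_left_cancel_le add.commute)
  also have "\<dots> \<le> ennreal (exp (- (133/200)))"
  proof (rule ennreal_leI)
    \<comment> \<open>Chosen so that \<open>4 * ?a = ?\<mu>\<^sup>2 / 2 + 133/200\<close>. Taking a
      quarter and then a fourth power keeps the cubic minorant accurate.\<close>
    let ?a = "973/3200 :: real"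
    have "737/1000 \<le> 1 - ?a + ?a\<^sup>2 / 2 - ?a ^ 3 / 6"
      by (simp add: power2_eq_square power3_eq_cube)
    also have "\<dots> \<le> exp (- ?a)" by (rule exp_neg_ge_cubic) simp
    finally have "(737/1000) ^ 4 \<le> exp (- ?a) ^ 4" by (intro power_mono) auto
    also have "\<dots> = exp (- (4 * ?a))" by (simp flip: exp_of_nat_mult)
    finally have "295/1000 \<le> exp (- (4 * ?a))" by (simp add: eval_nat_numeral)
    then have "exp (?\<mu>\<^sup>2 / 2) * (295/1000) \<le> exp (?\<mu>\<^sup>2 / 2) * exp (- (4 * ?a))" by simp
    also have "\<dots> = exp (- (133/200))"
      by (simp add: mult_exp_exp power2_eq_square)
    finally show "exp (?\<mu>\<^sup>2 / 2) * (295/1000) \<le> exp (- (133/200))" .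
  qed
  finally show ?thesis .
qed

text \<open>The exponential of the squared norm of \<open>\<tau> *\<^sub>R X\<close> is the Gaussian
  average of exponentials of linear forms in \<open>X\<close>. After exchanging the integrals,
  \<open>mgf\<close> applies for each fixed Gaussian vector, and a Gaussian integral of
  \<open>exp (y * (norm g)\<^sup>2 / 2)\<close> remains. This bounds the norm without a net over the
  directions. The exponent simplifies by \<open>1 + t \<le> exp t\<close>.\<close>

lemma norm_tail_of_mgf:
  fixes X :: "'b \<Rightarrow> 'a::euclidean_space" and s t :: real
  assumes "prob_space M" and [measurable]: "X \<in> borel_measurable M"
    and s: "s > 0" and t: "t > 0"
    and mgf: "\<And>w. (\<integral>\<^sup>+x. ennreal (exp (w \<bullet> X x)) \<partial>M) \<le> ennreal (exp (s\<^sup>2 * (norm w)\<^sup>2 / 2))"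
  shows "measure M {x\<in>space M. norm (X x) \<ge> s * sqrt DIM('a) * (1 + t)} \<le> exp (- (DIM('a) * t\<^sup>2 / 2))"
proof -
  interpret M: prob_space M by fact
  interpret G: prob_space "gauss :: 'a measure" by (rule prob_space_gauss)
  interpret MG: pair_sigma_finite M "gauss :: 'a measure" ..
  define d where "d = DIM('a)"
  define \<rho> where "\<rho> = 1 + t"
  \<comment> \<open>This \<open>y\<close> minimises the Markov bound
    \<open>(1 - y) powr (- d / 2) * exp (- y * d * \<rho>\<^sup>2 / 2)\<close>.\<close>
  define y where "y = 1 - 1 / \<rho>\<^sup>2"
  define \<tau> where "\<tau> = sqrt y / s"
  have rho: "\<rho> > 1" using t by (simp add: \<rho>_def)
  have "\<rho>\<^sup>2 > 1" using rho by (simp add: power2_eq_square less_1_mult)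
  then have y: "0 < y" "y < 1" by (auto simp: y_def divide_less_eq)
  have tau: "\<tau>\<^sup>2 * s\<^sup>2 = y" using s y by (simp add: \<tau>_def power_divide)
  define K where "K = y * d * \<rho>\<^sup>2 / 2"
  let ?A = "{x\<in>space M. norm (X x) \<ge> s * sqrt d * \<rho>}"
  have "ennreal (exp K) * emeasure M ?A = (\<integral>\<^sup>+x. ennreal (exp K) * indicator ?A x \<partial>M)"
    by (rule nn_integral_cmult_indicator[symmetric]) measurable
  also have "\<dots> \<le> (\<integral>\<^sup>+x. ennreal (exp ((norm (\<tau> *\<^sub>R X x))\<^sup>2 / 2)) \<partial>M)"
  proof (intro nn_integral_mono)
    fix x
    have "K \<le> (norm (\<tau> *\<^sub>R X x))\<^sup>2 / 2" if "x \<in> ?A"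
    proof -
      have "(s * sqrt d * \<rho>)\<^sup>2 \<le> (norm (X x))\<^sup>2"
        using that s rho by (intro power_mono) auto
      then have "\<tau>\<^sup>2 * (s * sqrt d * \<rho>)\<^sup>2 \<le> \<tau>\<^sup>2 * (norm (X x))\<^sup>2"
        by (intro mult_left_mono) auto
      also have "\<tau>\<^sup>2 * (s * sqrt d * \<rho>)\<^sup>2 = 2 * K"
        unfolding K_def tau[symmetric] by (simp add: power_mult_distrib)
      finally show ?thesis by (simp add: power_mult_distrib)
    qed
    then show "ennreal (exp K) * indicator ?A x \<le> ennreal (exp ((norm (\<tau> *\<^sub>R X x))\<^sup>2 / 2))"
      by (auto simp: indicator_def intro!: ennreal_leI)
  qed
  also have "\<dots> = (\<integral>\<^sup>+x. \<integral>\<^sup>+g. ennreal (exp ((\<tau> *\<^sub>R X x) \<bullet> g)) \<partial>gauss \<partial>M)"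
    by (simp only: nn_integral_gauss_exp_inner)
  also have "\<dots> = (\<integral>\<^sup>+g. \<integral>\<^sup>+x. ennreal (exp ((\<tau> *\<^sub>R X x) \<bullet> g)) \<partial>M \<partial>gauss)"
    by (rule MG.Fubini'[symmetric]) measurable
  also have "\<dots> \<le> (\<integral>\<^sup>+(g::'a). ennreal (exp (y * (norm g)\<^sup>2 / 2)) \<partial>gauss)"
  proof (intro nn_integral_mono)
    fix g :: 'a
    have "(\<integral>\<^sup>+x. ennreal (exp ((\<tau> *\<^sub>R X x) \<bullet> g)) \<partial>M) = (\<integral>\<^sup>+x. ennreal (exp ((\<tau> *\<^sub>R g) \<bullet> X x)) \<partial>M)"
      by (simp add: inner_commute)
    also have "\<dots> \<le> ennreal (exp (s\<^sup>2 * (norm (\<tau> *\<^sub>R g))\<^sup>2 / 2))" by (rule mgf)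
    also have "s\<^sup>2 * (norm (\<tau> *\<^sub>R g))\<^sup>2 = y * (norm g)\<^sup>2"
      using tau by (simp add: power_mult_distrib mult_ac)
    finally show "(\<integral>\<^sup>+x. ennreal (exp ((\<tau> *\<^sub>R X x) \<bullet> g)) \<partial>M) \<le> ennreal (exp (y * (norm g)\<^sup>2 / 2))" .
  qed
  also have "\<dots> = ennreal (\<rho> ^ d)"
    using y rho by (subst nn_integral_gauss_exp_norm) (auto simp: y_def d_def real_sqrt_divide)
  finally have "exp K * measure M ?A \<le> \<rho> ^ d"
    using rho by (simp add: M.emeasure_eq_measure ennreal_mult'[symmetric])
  also have "\<rho> ^ d \<le> exp t ^ d"
    using exp_ge_add_one_self[of t] t by (intro power_mono) (auto simp: \<rho>_def)
  also have "exp t ^ d = exp (d * t)"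
    by (simp add: exp_of_nat_mult)
  finally have "measure M ?A \<le> exp (d * t) / exp K"
    by (simp add: field_simps)
  also have "\<dots> = exp (- (d * t\<^sup>2 / 2))"
  proof -
    have "y * \<rho>\<^sup>2 = 2 * t + t\<^sup>2"
    proof -
      have "y * \<rho>\<^sup>2 = \<rho>\<^sup>2 - 1" using rho by (simp add: y_def left_diff_distrib)
      then show ?thesis by (simp add: \<rho>_def power2_sum)
    qed
    then have "K = d * (2 * t + t\<^sup>2) / 2" unfolding K_def by (simp add: mult_ac)
    then show ?thesis by (simp add: exp_diff[symmetric] field_simps)
  qed
  finally show ?thesis by (simp add: \<rho>_def d_def)
qed

section \<open>Uniform bounds for sums of absolute inner products\<close>

lemma (in prob_space) finite_union_bound_event:
  fixes p :: real
  assumes "finite K" and B: "\<And>k. k \<in> K \<Longrightarrow> B k \<in> events" "\<And>k. k \<in> K \<Longrightarrow> prob (B k) \<le> p"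
  shows "\<exists>G\<in>events. prob G \<ge> 1 - card K * p \<and> (\<forall>x\<in>G. \<forall>k\<in>K. x \<notin> B k)"
proof -
  define U where "U = (\<Union>k\<in>K. B k)"
  have U: "U \<in> events" unfolding U_def using assms by auto
  have "prob U \<le> (\<Sum>k\<in>K. prob (B k))"
    unfolding U_def using assms by (intro finite_measure_subadditive_finite) auto
  also have "\<dots> \<le> (\<Sum>k\<in>K. p)" by (intro sum_mono B)
  finally have "prob U \<le> card K * p" by simp
  then have "prob (space M - U) \<ge> 1 - card K * p"
    using U by (simp add: prob_compl)
  then show ?thesis
    using U by (intro bexI[of _ "space M - U"]) (auto simp: U_def)
qed

lemma nn_integral_PiM_subset_prod:
  fixes f :: "'i \<Rightarrow> 'b \<Rightarrow> ennreal"
  assumes N: "\<And>i. prob_space (N i)" and I: "finite I" "J \<subseteq> I"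
    and f: "\<And>i. i \<in> J \<Longrightarrow> f i \<in> borel_measurable (N i)"
  shows "(\<integral>\<^sup>+\<omega>. (\<Prod>i\<in>J. f i (\<omega> i)) \<partial>PiM I N) = (\<Prod>i\<in>J. \<integral>\<^sup>+x. f i x \<partial>N i)"
proof -
  interpret N: prob_space "N i" for i by (rule N)
  interpret P: product_prob_space N I by unfold_locales
  define g where "g i = (if i \<in> J then f i else (\<lambda>_. 1))" for i
  have "(\<integral>\<^sup>+\<omega>. (\<Prod>i\<in>J. f i (\<omega> i)) \<partial>PiM I N) = (\<integral>\<^sup>+\<omega>. (\<Prod>i\<in>I. g i (\<omega> i)) \<partial>PiM I N)"
    by (intro nn_integral_cong prod.mono_neutral_cong_left) (use I in \<open>auto simp: g_def\<close>)
  also have "\<dots> = (\<Prod>i\<in>I. \<integral>\<^sup>+x. g i x \<partial>N i)"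
    by (rule P.product_nn_integral_prod) (use I f in \<open>auto simp: g_def\<close>)
  also have "\<dots> = (\<Prod>i\<in>J. \<integral>\<^sup>+x. f i x \<partial>N i)"
    by (intro prod.mono_neutral_cong_right) (use I N.emeasure_space_1 in \<open>auto simp: g_def\<close>)
  finally show ?thesis .
qed

section \<open>Suprema of absolute sums via sign patterns\<close>

lemma signed_sum_mgf:
  fixes f :: "'i \<Rightarrow> 'b \<Rightarrow> 'a::euclidean_space"
  assumes N: "\<And>i. prob_space (N i)" and I: "finite I" "J \<subseteq> I"
    and f[measurable]: "\<And>i. i \<in> J \<Longrightarrow> f i \<in> borel_measurable (N i)"
    and mgf: "\<And>i w. i \<in> J \<Longrightarrow> (\<integral>\<^sup>+x. ennreal (exp (w \<bullet> f i x)) \<partial>N i) \<le> ennreal (exp (a * (norm w)\<^sup>2 / 2))"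
    and eps: "\<And>i. i \<in> J \<Longrightarrow> \<epsilon> i \<in> {1, -1::real}"
  shows "(\<integral>\<^sup>+\<omega>. ennreal (exp (w \<bullet> (\<Sum>i\<in>J. \<epsilon> i *\<^sub>R f i (\<omega> i)))) \<partial>PiM I N) \<le>
    ennreal (exp (a * card J * (norm w)\<^sup>2 / 2))"
proof -
  have "(\<integral>\<^sup>+\<omega>. ennreal (exp (w \<bullet> (\<Sum>i\<in>J. \<epsilon> i *\<^sub>R f i (\<omega> i)))) \<partial>PiM I N) =
     (\<integral>\<^sup>+\<omega>. (\<Prod>i\<in>J. (\<lambda>x. ennreal (exp ((\<epsilon> i *\<^sub>R w) \<bullet> f i x))) (\<omega> i)) \<partial>PiM I N)"
    using finite_subset[OF I(2,1)]
    by (simp add: inner_sum_right exp_sum prod_ennreal)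
  also have "\<dots> = (\<Prod>i\<in>J. \<integral>\<^sup>+x. ennreal (exp ((\<epsilon> i *\<^sub>R w) \<bullet> f i x)) \<partial>N i)"
    by (rule nn_integral_PiM_subset_prod[OF N I]) measurable
  also have "\<dots> \<le> (\<Prod>i\<in>J. ennreal (exp (a * (norm w)\<^sup>2 / 2)))"
  proof (intro prod_mono_ennreal)
    fix i assume i: "i \<in> J"
    have "\<bar>\<epsilon> i\<bar> = 1" using eps[OF i] by auto
    then show "(\<integral>\<^sup>+x. ennreal (exp ((\<epsilon> i *\<^sub>R w) \<bullet> f i x)) \<partial>N i) \<le> ennreal (exp (a * (norm w)\<^sup>2 / 2))"
      using mgf[OF i, of "\<epsilon> i *\<^sub>R w"] by simp
  qed
  also have "\<dots> = ennreal (exp (a * card J * (norm w)\<^sup>2 / 2))"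
    by (simp add: ennreal_power exp_of_nat_mult[symmetric] mult_ac)
  finally show ?thesis .
qed

text \<open>Choosing each sign to match that of \<open>u \<bullet> y i\<close> makes the absolute
  sum linear in \<open>u\<close>. Thus finitely many norms, one for each sign pattern, control a
  continuum of directions.\<close>

lemma sum_abs_inner_le_of_signs:
  fixes y :: "'i \<Rightarrow> 'a::euclidean_space"
  assumes R: "\<And>\<epsilon>. \<epsilon> \<in> (J \<rightarrow>\<^sub>E {1, -1::real}) \<Longrightarrow> norm (\<Sum>i\<in>J. \<epsilon> i *\<^sub>R y i) \<le> R"
  shows "(\<Sum>i\<in>J. \<bar>u \<bullet> y i\<bar>) \<le> R * norm u"
proof -
  define \<epsilon> where "\<epsilon> = (\<lambda>i\<in>J. if u \<bullet> y i \<ge> 0 then 1 else -1::real)"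
  have "(\<Sum>i\<in>J. \<bar>u \<bullet> y i\<bar>) = u \<bullet> (\<Sum>i\<in>J. \<epsilon> i *\<^sub>R y i)"
    by (auto simp: inner_sum_right \<epsilon>_def intro!: sum.cong)
  also have "\<dots> \<le> norm u * norm (\<Sum>i\<in>J. \<epsilon> i *\<^sub>R y i)"
    by (rule norm_cauchy_schwarz)
  also have "\<dots> \<le> norm u * R"
    by (intro mult_left_mono R) (auto simp: \<epsilon>_def)
  finally show ?thesis by (simp add: mult.commute)
qed

lemma sup_abs_sum_event:
  fixes f :: "'i \<Rightarrow> 'b \<Rightarrow> 'a::euclidean_space" and t :: real
  assumes N: "\<And>i. prob_space (N i)" and I: "finite I" "J \<subseteq> I" and J: "J \<noteq> {}" and t: "t > 0"
    and f[measurable]: "\<And>i. i \<in> J \<Longrightarrow> f i \<in> borel_measurable (N i)"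
    and mgf: "\<And>i w. i \<in> J \<Longrightarrow> (\<integral>\<^sup>+x. ennreal (exp (w \<bullet> f i x)) \<partial>N i) \<le> ennreal (exp ((norm w)\<^sup>2 / (2 * DIM('a))))"
  shows "\<exists>G\<in>sets (PiM I N). measure (PiM I N) G \<ge> 1 - 2 ^ card J * exp (- (DIM('a) * t\<^sup>2 / 2)) \<and>
    (\<forall>\<omega>\<in>G. \<forall>u. (\<Sum>i\<in>J. \<bar>u \<bullet> f i (\<omega> i)\<bar>) \<le> sqrt (card J) * (1 + t) * norm u)"
proof -
  interpret N: prob_space "N i" for i by (rule N)
  interpret P: product_prob_space N I by unfold_locales
  have finJ: "finite J" using I finite_subset by blast
  \<comment> \<open>Each signed sum has variance proxy \<open>card J / d\<close> per direction, so
    its norm is of order \<open>sqrt (card J)\<close>.\<close>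
  define s where "s = sqrt (card J / DIM('a))"
  have s: "s > 0" using J finJ by (simp add: s_def card_gt_0_iff)
  have ssq: "s * sqrt DIM('a) = sqrt (card J)" by (simp add: s_def real_sqrt_divide)
  define B where "B \<epsilon> = {\<omega>\<in>space (PiM I N). norm (\<Sum>i\<in>J. \<epsilon> i *\<^sub>R f i (\<omega> i)) \<ge> s * sqrt DIM('a) * (1 + t)}" for \<epsilon>
  have fm: "(\<lambda>\<omega>. f i (\<omega> i)) \<in> borel_measurable (PiM I N)" if "i \<in> J" for i
    using measurable_compose[OF measurable_component_singleton[of i I N] f[of i]] that I by auto
  have m: "(\<lambda>\<omega>. \<Sum>i\<in>J. \<epsilon> i *\<^sub>R f i (\<omega> i)) \<in> borel_measurable (PiM I N)" for \<epsilon>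
    by (intro borel_measurable_sum borel_measurable_scaleR borel_measurable_const fm)
  have "P.prob (B \<epsilon>) \<le> exp (- (DIM('a) * t\<^sup>2 / 2))" if "\<epsilon> \<in> J \<rightarrow>\<^sub>E {1, -1}" for \<epsilon>
    unfolding B_def
  proof (rule norm_tail_of_mgf[OF P.prob_space_axioms m s t])
    fix w :: 'a
    have "(\<integral>\<^sup>+\<omega>. ennreal (exp (w \<bullet> (\<Sum>i\<in>J. \<epsilon> i *\<^sub>R f i (\<omega> i)))) \<partial>PiM I N) \<le>
      ennreal (exp ((1 / DIM('a)) * card J * (norm w)\<^sup>2 / 2))"
      using mgf that by (intro signed_sum_mgf[OF N I f]) (auto simp: mult.commute PiE_iff)
    then show "(\<integral>\<^sup>+\<omega>. ennreal (exp (w \<bullet> (\<Sum>i\<in>J. \<epsilon> i *\<^sub>R f i (\<omega> i)))) \<partial>PiM I N) \<le>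
      ennreal (exp (s\<^sup>2 * (norm w)\<^sup>2 / 2))"
      by (simp add: s_def)
  qed
  moreover have "B \<epsilon> \<in> P.events" for \<epsilon>
    unfolding B_def using m[of \<epsilon>] by measurable
  ultimately obtain G where G: "G \<in> P.events"
      "P.prob G \<ge> 1 - card (J \<rightarrow>\<^sub>E {1, -1::real}) * exp (- (DIM('a) * t\<^sup>2 / 2))"
      "\<forall>\<omega>\<in>G. \<forall>\<epsilon>\<in>J \<rightarrow>\<^sub>E {1, -1}. \<omega> \<notin> B \<epsilon>"
    using P.finite_union_bound_event[of "J \<rightarrow>\<^sub>E {1, -1::real}" B "exp (- (DIM('a) * t\<^sup>2 / 2))"] finJ
    by (auto simp: finite_PiE)
  have "card (J \<rightarrow>\<^sub>E {1, -1::real}) = 2 ^ card J"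
    using finJ by (simp add: card_PiE numeral_2_eq_2)
  moreover have "(\<Sum>i\<in>J. \<bar>u \<bullet> f i (\<omega> i)\<bar>) \<le> sqrt (card J) * (1 + t) * norm u" if "\<omega> \<in> G" for \<omega> u
  proof (rule sum_abs_inner_le_of_signs)
    fix \<epsilon> :: "'i \<Rightarrow> real" assume "\<epsilon> \<in> J \<rightarrow>\<^sub>E {1, -1}"
    then have "\<omega> \<notin> B \<epsilon>" using G(3) that by blast
    moreover have "\<omega> \<in> space (PiM I N)" using that G(1) sets.sets_into_space by blast
    ultimately show "norm (\<Sum>i\<in>J. \<epsilon> i *\<^sub>R f i (\<omega> i)) \<le> sqrt (card J) * (1 + t)"
      by (simp add: B_def ssq)
  qed
  ultimately show ?thesis using G(1,2) by (intro bexI[of _ G]) auto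
qed

text \<open>Markov's inequality for the exponential of \<open>- c\<close> times the sum; by
  independence its mean is a product of at most \<open>q\<close> for each index.\<close>

lemma abs_sum_lower_tail:
  fixes f :: "'i \<Rightarrow> 'b \<Rightarrow> 'a::euclidean_space" and c q \<tau> :: real
  assumes N: "\<And>i. prob_space (N i)" and I: "finite I" "J \<subseteq> I" and q: "q \<ge> 0" and c: "c \<ge> 0"
    and f[measurable]: "\<And>i. i \<in> J \<Longrightarrow> f i \<in> borel_measurable (N i)"
    and mgf: "\<And>i. i \<in> J \<Longrightarrow> (\<integral>\<^sup>+x. ennreal (exp (- (c * \<bar>u \<bullet> f i x\<bar>))) \<partial>N i) \<le> ennreal q"
  shows "measure (PiM I N) {\<omega>\<in>space (PiM I N). (\<Sum>i\<in>J. \<bar>u \<bullet> f i (\<omega> i)\<bar>) \<le> \<tau>} \<le> exp (c * \<tau>) * q ^ card J"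
proof -
  interpret N: prob_space "N i" for i by (rule N)
  interpret P: product_prob_space N I by unfold_locales
  let ?B = "{\<omega>\<in>space (PiM I N). (\<Sum>i\<in>J. \<bar>u \<bullet> f i (\<omega> i)\<bar>) \<le> \<tau>}"
  have finJ: "finite J" using I finite_subset by blast
  have fm: "(\<lambda>\<omega>. f i (\<omega> i)) \<in> borel_measurable (PiM I N)" if "i \<in> J" for i
    using measurable_compose[OF measurable_component_singleton[of i I N] f[of i]] that I by auto
  have "(\<lambda>\<omega>. \<Sum>i\<in>J. \<bar>u \<bullet> f i (\<omega> i)\<bar>) \<in> borel_measurable (PiM I N)"
    by (intro borel_measurable_sum borel_measurable_abs borel_measurable_inner borel_measurable_const fm)
  then have B: "?B \<in> P.events" by measurable
  have "emeasure (PiM I N) ?B = (\<integral>\<^sup>+\<omega>. indicator ?B \<omega> \<partial>PiM I N)"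
    using B by simp
  also have "\<dots> \<le> (\<integral>\<^sup>+\<omega>. ennreal (exp (c * \<tau>)) * (\<Prod>i\<in>J. ennreal (exp (- (c * \<bar>u \<bullet> f i (\<omega> i)\<bar>)))) \<partial>PiM I N)"
  proof (intro nn_integral_mono)
    fix \<omega>
    have "1 \<le> exp (c * \<tau>) * (\<Prod>i\<in>J. exp (- (c * \<bar>u \<bullet> f i (\<omega> i)\<bar>)))" if "\<omega> \<in> ?B"
    proof -
      have "c * (\<Sum>i\<in>J. \<bar>u \<bullet> f i (\<omega> i)\<bar>) \<le> c * \<tau>" using that c by (auto intro: mult_left_mono)
      then have "0 \<le> c * \<tau> + (\<Sum>i\<in>J. - (c * \<bar>u \<bullet> f i (\<omega> i)\<bar>))" by (simp add: sum_distrib_left sum_negf)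
      then have "1 \<le> exp (c * \<tau> + (\<Sum>i\<in>J. - (c * \<bar>u \<bullet> f i (\<omega> i)\<bar>)))" by simp
      then show ?thesis using finJ by (simp only: exp_add exp_sum)
    qed
    then show "indicator ?B \<omega> \<le> ennreal (exp (c * \<tau>)) * (\<Prod>i\<in>J. ennreal (exp (- (c * \<bar>u \<bullet> f i (\<omega> i)\<bar>))))"
      by (auto simp: indicator_def prod_ennreal ennreal_mult'[symmetric] simp flip: ennreal_1 intro!: ennreal_leI)
  qed
  also have "\<dots> = ennreal (exp (c * \<tau>)) * (\<integral>\<^sup>+\<omega>. (\<Prod>i\<in>J. (\<lambda>x. ennreal (exp (- (c * \<bar>u \<bullet> f i x\<bar>)))) (\<omega> i)) \<partial>PiM I N)"
    by (intro nn_integral_cmult borel_measurable_prod_ennreal) (use fm in measurable)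
  also have "(\<integral>\<^sup>+\<omega>. (\<Prod>i\<in>J. (\<lambda>x. ennreal (exp (- (c * \<bar>u \<bullet> f i x\<bar>)))) (\<omega> i)) \<partial>PiM I N) =
     (\<Prod>i\<in>J. \<integral>\<^sup>+x. ennreal (exp (- (c * \<bar>u \<bullet> f i x\<bar>))) \<partial>N i)"
    by (rule nn_integral_PiM_subset_prod[OF N I]) measurable
  also have "ennreal (exp (c * \<tau>)) * \<dots> \<le> ennreal (exp (c * \<tau>)) * (\<Prod>i\<in>J. ennreal q)"
    by (intro mult_left_mono prod_mono_ennreal mgf) auto
  also have "\<dots> = ennreal (exp (c * \<tau>) * q ^ card J)"
    using q by (simp add: ennreal_power ennreal_mult')
  finally show ?thesis
    using q by (simp add: P.emeasure_eq_measure)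
qed

section \<open>Packing and covering of the sphere\<close>

lemma card_separated_sphere_le:
  fixes S :: "'a::euclidean_space set"
  assumes S: "finite S" "S \<subseteq> sphere 0 1" and sep: "pairwise (\<lambda>x y. dist x y > \<epsilon>) S" and e: "\<epsilon> > 0"
  shows "real (card S) \<le> (1 + 2 / \<epsilon>) ^ DIM('a)"
proof -
  let ?d = "DIM('a)"
  let ?v = "unit_ball_vol (real ?d)"
  have v: "?v > 0" by simp
  have "disjoint_family_on (\<lambda>x. ball x (\<epsilon> / 2)) S"
    unfolding disjoint_family_on_def
  proof (intro ballI impI)
    fix x y assume "x \<in> S" "y \<in> S" "x \<noteq> y"
    then have "dist x y > \<epsilon>" using sep by (auto simp: pairwise_def)
    show "ball x (\<epsilon> / 2) \<inter> ball y (\<epsilon> / 2) = {}"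
    proof (rule ccontr)
      assume "ball x (\<epsilon> / 2) \<inter> ball y (\<epsilon> / 2) \<noteq> {}"
      then obtain z where "dist x z < \<epsilon> / 2" "dist y z < \<epsilon> / 2" by auto
      then have "dist x y < \<epsilon>" using dist_triangle[of x y z] by (simp add: dist_commute)
      with \<open>dist x y > \<epsilon>\<close> show False by simp
    qed
  qed
  then have "measure lborel (\<Union>x\<in>S. ball x (\<epsilon> / 2)) = (\<Sum>x\<in>S. measure lborel (ball x (\<epsilon> / 2)))"
    using S emeasure_bounded_finite[OF bounded_ball]
    by (intro measure_finite_Union) (auto simp: less_top[symmetric])
  also have "\<dots> = card S * (?v * (\<epsilon> / 2) ^ ?d)"
    using e by (simp add: measure_def emeasure_ball)
  finally have 1: "measure lborel (\<Union>x\<in>S. ball x (\<epsilon> / 2)) = card S * (?v * (\<epsilon> / 2) ^ ?d)" .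
  have "(\<Union>x\<in>S. ball x (\<epsilon> / 2)) \<subseteq> ball 0 (1 + \<epsilon> / 2)"
  proof
    fix z assume "z \<in> (\<Union>x\<in>S. ball x (\<epsilon> / 2))"
    then obtain x where "x \<in> S" "dist x z < \<epsilon> / 2" by auto
    moreover have "norm x = 1" using S \<open>x \<in> S\<close> by auto
    ultimately show "z \<in> ball 0 (1 + \<epsilon> / 2)"
      using dist_triangle[of 0 z x] by simp
  qed
  then have "measure lborel (\<Union>x\<in>S. ball x (\<epsilon> / 2)) \<le> measure lborel (ball (0::'a) (1 + \<epsilon> / 2))"
    using emeasure_bounded_finite[OF bounded_ball, of "0::'a" "1 + \<epsilon> / 2"] by (intro measure_mono_fmeasurable) (auto simp: fmeasurable_def intro!: borel_open open_UN)
  also have "\<dots> = ?v * (1 + \<epsilon> / 2) ^ ?d"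
    using e by (simp add: measure_def emeasure_ball)
  finally have "card S * (\<epsilon> / 2) ^ ?d \<le> (1 + \<epsilon> / 2) ^ ?d"
    using 1 v by (simp add: mult.left_commute)
  then have "card S \<le> (1 + \<epsilon> / 2) ^ ?d / (\<epsilon> / 2) ^ ?d"
    using e by (simp add: pos_le_divide_eq)
  also have "\<dots> = ((1 + \<epsilon> / 2) / (\<epsilon> / 2)) ^ ?d" by (rule power_divide[symmetric])
  also have "(1 + \<epsilon> / 2) / (\<epsilon> / 2) = 1 + 2 / \<epsilon>" using e by (simp add: field_simps)
  finally show ?thesis .
qed

text \<open>A separated set of greatest cardinality is a net, since a point far from all its members
  could be added. The packing bound guarantees that a greatest cardinality exists.\<close>

lemma sphere_net:
  assumes e: "\<epsilon> > 0"
  obtains S :: "'a::euclidean_space set" where "finite S" "S \<subseteq> sphere 0 1"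
    "real (card S) \<le> (1 + 2 / \<epsilon>) ^ DIM('a)" "\<And>u. norm u = 1 \<Longrightarrow> \<exists>v\<in>S. dist u v \<le> \<epsilon>"
proof -
  let ?P = "\<lambda>S::'a set. finite S \<and> S \<subseteq> sphere 0 1 \<and> pairwise (\<lambda>x y. dist x y > \<epsilon>) S"
  have "\<exists>S. ?P S \<and> (\<forall>T. ?P T \<longrightarrow> card T \<le> card S)"
  proof (rule ex_has_greatest_nat[where P="?P" and f=card])
    show "?P {}" by simp
    show "\<forall>T. ?P T \<longrightarrow> card T < Suc (nat \<lfloor>(1 + 2 / \<epsilon>) ^ DIM('a)\<rfloor>)"
      using card_separated_sphere_le e by (auto intro!: le_nat_floor simp: less_Suc_eq_le)
  qed
  then obtain S where S: "?P S" "\<And>T. ?P T \<Longrightarrow> card T \<le> card S" by blast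
  show ?thesis
  proof (rule that)
    show "finite S" "S \<subseteq> sphere 0 1" using S by auto
    show "real (card S) \<le> (1 + 2 / \<epsilon>) ^ DIM('a)"
      using S e by (intro card_separated_sphere_le) auto
    fix u :: 'a assume u: "norm u = 1"
    show "\<exists>v\<in>S. dist u v \<le> \<epsilon>"
    proof (rule ccontr)
      assume "\<not> ?thesis"
      then have far: "\<And>v. v \<in> S \<Longrightarrow> dist u v > \<epsilon>" by auto
      then have "u \<notin> S" using e by fastforce
      moreover have "?P (insert u S)"
        using S far u by (auto simp: pairwise_insert dist_commute)
      ultimately show False using S(2)[of "insert u S"] S(1) by simp
    qed
  qed
qed

section \<open>Numerical bounds and the net argument\<close>

text \<open>The deviation \<open>t\<close> is solved from the requirement that a union over
  \<open>2 ^ n\<close> sign patterns leaves the probability \<open>exp (- L)\<close>.\<close>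

lemma two_power_mult_exp:
  fixes L d :: real and n :: nat
  assumes d: "d > 0" and L: "L > 0"
  defines "t \<equiv> sqrt (2 * (real n * ln 2 + L) / d)"
  shows "t > 0" "2 ^ n * exp (- (d * t\<^sup>2 / 2)) = exp (- L)"
proof -
  have nn: "real n * ln 2 + L > 0" using L by (intro add_nonneg_pos) auto
  then show "t > 0" using d by (simp add: t_def)
  have "t\<^sup>2 = 2 * (real n * ln 2 + L) / d" unfolding t_def using nn d by simp
  then have "d * t\<^sup>2 / 2 = real n * ln 2 + L" using d by simp
  moreover have "(2::real) ^ n = exp (real n * ln 2)" by (simp add: exp_of_nat_mult)
  ultimately have "2 ^ n * exp (- (d * t\<^sup>2 / 2)) = exp (real n * ln 2) * exp (- (real n * ln 2 + L))"
    by (simp only:)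
  then show "2 ^ n * exp (- (d * t\<^sup>2 / 2)) = exp (- L)"
    by (simp add: mult_exp_exp)
qed

lemma sup_abs_sum_event_delta:
  fixes f :: "'i \<Rightarrow> 'b \<Rightarrow> 'a::euclidean_space" and \<delta> :: real
  assumes N: "\<And>i. prob_space (N i)" and I: "finite I" "J \<subseteq> I" and J: "J \<noteq> {}" and \<delta>: "0 < \<delta>" "\<delta> < 1"
    and f: "\<And>i. i \<in> J \<Longrightarrow> f i \<in> borel_measurable (N i)"
    and mgf: "\<And>i w. i \<in> J \<Longrightarrow> (\<integral>\<^sup>+x. ennreal (exp (w \<bullet> f i x)) \<partial>N i) \<le> ennreal (exp ((norm w)\<^sup>2 / (2 * DIM('a))))"
  shows "\<exists>G\<in>sets (PiM I N). measure (PiM I N) G \<ge> 1 - \<delta> \<and>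
    (\<forall>\<omega>\<in>G. \<forall>u. (\<Sum>i\<in>J. \<bar>u \<bullet> f i (\<omega> i)\<bar>) \<le>
      sqrt (card J) * (1 + sqrt (2 * (card J * ln 2 + ln (1 / \<delta>)) / DIM('a))) * norm u)"
proof -
  have L: "ln (1 / \<delta>) > 0" using \<delta> by simp
  have "exp (- ln (1 / \<delta>)) = \<delta>" using \<delta> by (simp add: ln_div)
  then show ?thesis
    using sup_abs_sum_event[OF N I J two_power_mult_exp(1)[of "DIM('a)" "ln (1 / \<delta>)" "card J"] f mgf]
      two_power_mult_exp(2)[of "DIM('a)" "ln (1 / \<delta>)" "card J"] L by simp
qed

text \<open>The absolute sum is a seminorm, and \<open>up\<close> makes it Lipschitz with constant
  \<open>R\<close>. Moving from a unit vector to a net point therefore costs at most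
  \<open>R * \<epsilon>\<close>; general vectors follow by scaling.\<close>

lemma abs_sum_lower_from_net:
  fixes y :: "'i \<Rightarrow> 'a::euclidean_space" and R \<tau> \<epsilon> :: real
  assumes net: "\<And>u. norm u = 1 \<Longrightarrow> \<exists>v\<in>S. dist u v \<le> \<epsilon>"
    and low: "\<And>v. v \<in> S \<Longrightarrow> \<tau> \<le> (\<Sum>i\<in>J. \<bar>v \<bullet> y i\<bar>)"
    and up: "\<And>u. (\<Sum>i\<in>J. \<bar>u \<bullet> y i\<bar>) \<le> R * norm u" and R: "R \<ge> 0"
  shows "(\<tau> - R * \<epsilon>) * norm u \<le> (\<Sum>i\<in>J. \<bar>u \<bullet> y i\<bar>)"
proof (cases "u = 0")
  case False
  define e where "e = u /\<^sub>R norm u"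
  have "norm e = 1" using False by (simp add: e_def)
  then obtain v where v: "v \<in> S" "dist e v \<le> \<epsilon>" using net by blast
  have "\<tau> \<le> (\<Sum>i\<in>J. \<bar>v \<bullet> y i\<bar>)" by (rule low[OF v(1)])
  also have "\<dots> \<le> (\<Sum>i\<in>J. \<bar>e \<bullet> y i\<bar> + \<bar>(v - e) \<bullet> y i\<bar>)"
    by (intro sum_mono) (simp add: inner_diff_left)
  also have "\<dots> \<le> (\<Sum>i\<in>J. \<bar>e \<bullet> y i\<bar>) + R * norm (v - e)"
    using up[of "v - e"] by (simp add: sum.distrib)
  also have "R * norm (v - e) \<le> R * \<epsilon>"
    using v(2) R by (intro mult_left_mono) (auto simp: dist_norm norm_minus_commute)
  finally have "\<tau> - R * \<epsilon> \<le> (\<Sum>i\<in>J. \<bar>e \<bullet> y i\<bar>)" by simp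
  then have "(\<tau> - R * \<epsilon>) * norm u \<le> (\<Sum>i\<in>J. \<bar>e \<bullet> y i\<bar>) * norm u"
    by (rule mult_right_mono) simp
  also have "\<dots> = (\<Sum>i\<in>J. \<bar>u \<bullet> y i\<bar>)"
    using False by (auto simp: e_def sum_distrib_right abs_mult intro!: sum.cong)
  finally show ?thesis .
qed simp

text \<open>
  Here \<open>2/31\<close> is the mesh of the net (at most \<open>32 ^ d\<close> points, and \<open>125/36\<close> bounds \<open>ln 32\<close>), \<open>21/20\<close>
  the Chernoff parameter, \<open>133/200\<close> the resulting exponent of the half-normal Laplace transform,
  \<open>39895/100000\<close> bounds \<open>1 / sqrt (2 * pi)\<close> and \<open>117852/100000\<close> bounds \<open>sqrt (2 * ln 2)\<close>. The factor
  \<open>1361/1000\<close> is what \<open>outlier_cost_bound\<close> requires: it exceeds \<open>2 * sqrt (2 * ln 2) / sqrt 3\<close>.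
\<close>

lemma net_exponent_nonpos:
  fixes x y z :: real
  assumes "x \<ge> 0" "y \<ge> 0" "x + y \<le> z" "z \<le> 39895/100000"
  shows "125/36 * x\<^sup>2 + 2 * y\<^sup>2 + 21/20 * (1361/1000 * (z - x - y) + 2/31 * (117852/100000 + x + 2 * y)) \<le> 133/200"
proof -
  \<comment> \<open>As \<open>x\<close> and \<open>y\<close> are at most \<open>z\<close>, their
    squares are dominated by multiples of \<open>x\<close> and \<open>y\<close>, and the claim
    becomes linear.\<close>
  have "x\<^sup>2 \<le> 39895/100000 * x" "y\<^sup>2 \<le> 39895/100000 * y"
    unfolding power2_eq_square by (rule mult_right_mono; use assms in linarith)+
  then show ?thesis using assms by argo
qed

text \<open>The left side is the logarithm of the size of the net times the Chernoff bound. After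
  division by \<open>n\<close> everything depends on three numbers: \<open>x\<close>,
  \<open>y\<close>, \<open>z\<close> are the three terms of \<open>A\<close> in units of
  \<open>n / sqrt d\<close>. In these units \<open>d\<close> becomes \<open>x\<^sup>2\<close>,
  \<open>L\<close> is at most \<open>2 * y\<^sup>2\<close>, and positivity of \<open>A\<close> reads
  \<open>x + y < z\<close>, which is what \<open>net_exponent_nonpos\<close> needs.\<close>

lemma net_union_bound:
  fixes n d L :: real
  assumes n: "n \<ge> 1" and d: "d \<ge> 2" and L: "L > 0"
  defines "A \<equiv> sqrt (1 / (2 * pi)) * n / sqrt d - sqrt n - sqrt (n * L / (2 * d - 2))"
  defines "R \<equiv> sqrt n * (1 + sqrt (2 * (n * ln 2 + L) / d))"
  assumes A: "A > 0"
  shows "d * ln 32 + 21/20 * sqrt d * (1361/1000 * A + R * (2/31)) - 133/200 * n \<le> - L"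
proof -
  define x where "x = sqrt (d / n)"
  define y where "y = sqrt (L * d / ((2 * d - 2) * n))"
  define z where "z = sqrt (1 / (2 * pi))"
  have sd: "sqrt d > 0" using d by simp
  have "n * x = sqrt (n\<^sup>2 * (d / n))"
    unfolding x_def real_sqrt_mult[of "n\<^sup>2"] using n by simp
  also have "n\<^sup>2 * (d / n) = n * d" using n by (simp add: power2_eq_square)
  finally have nx: "n * x = sqrt n * sqrt d" by (simp add: real_sqrt_mult)
  have "n * y = sqrt (n\<^sup>2 * (L * d / ((2 * d - 2) * n)))"
    unfolding y_def real_sqrt_mult[of "n\<^sup>2"] using n by simp
  also have "n\<^sup>2 * (L * d / ((2 * d - 2) * n)) = (n * L / (2 * d - 2)) * d" using n by (simp add: power2_eq_square)
  finally have ny: "n * y = sqrt (n * L / (2 * d - 2)) * sqrt d" by (simp only: real_sqrt_mult)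
  have sA: "sqrt d * A = n * (z - x - y)"
  proof -
    have "sqrt d * A = z * n - sqrt n * sqrt d - sqrt (n * L / (2 * d - 2)) * sqrt d"
      using sd by (simp add: A_def z_def right_diff_distrib mult_ac)
    then show ?thesis using nx ny by (simp add: right_diff_distrib mult.commute)
  qed
  have xy: "x + y \<le> z"
  proof -
    have "0 < n * (z - x - y)" using sA sd A by (metis mult_pos_pos)
    then have "0 < z - x - y" using n by (simp add: zero_less_mult_iff)
    then show ?thesis by simp
  qed
  have x0: "x \<ge> 0" using n d by (simp add: x_def)
  have y0: "y \<ge> 0" using n d L by (simp add: y_def)
  have z: "z \<le> 39895/100000"
  proof -
    have "1 / (2 * pi) \<le> (39895/100000)\<^sup>2"
      using pi_approx(1) by (simp add: field_simps power2_eq_square)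
    then show ?thesis unfolding z_def by (intro real_le_lsqrt) auto
  qed
  have Ln: "L \<le> n * (2 * y\<^sup>2)"
  proof -
    have "n * (2 * y\<^sup>2) = L * (2 * d / (2 * d - 2))"
      using n d L by (simp add: y_def field_simps)
    also have "\<dots> \<ge> L * 1"
      using d L by (intro mult_left_mono) (auto simp: field_simps)
    finally show ?thesis by simp
  qed
  have xx: "n * x\<^sup>2 = d" using n d by (simp add: x_def)
  have R: "sqrt d * R \<le> n * (117852/100000 + x + 2 * y)"
  proof -
    have "sqrt d * (sqrt n * sqrt (2 * (n * ln 2 + L) / d)) = sqrt (n * (2 * (n * ln 2 + L)))"
      using d by (simp add: real_sqrt_mult[symmetric] mult_ac)
    also have "\<dots> = sqrt (n\<^sup>2 * (2 * ln 2) + 2 * n * L)"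
      by (simp add: power2_eq_square algebra_simps)
    also have "\<dots> \<le> sqrt (n\<^sup>2 * (2 * ln 2)) + sqrt (2 * n * L)"
      using n L by (intro sqrt_add_le_add_sqrt) auto
    also have "sqrt (n\<^sup>2 * (2 * ln 2)) = n * sqrt (2 * ln 2)"
      using n by (simp add: real_sqrt_mult)
    also have "sqrt (2 * ln 2) \<le> 117852/100000"
      using ln2_le_25_over_36 by (intro real_le_lsqrt) (auto simp: power2_eq_square)
    also have "sqrt (2 * n * L) \<le> n * (2 * y)"
    proof (rule real_le_lsqrt)
      have "2 * n * L \<le> 2 * n * (n * (2 * y\<^sup>2))" using Ln n by (intro mult_left_mono) auto
      then show "2 * n * L \<le> (n * (2 * y))\<^sup>2" by (simp add: power2_eq_square algebra_simps)
    qed (use n y0 in auto)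
    finally have "sqrt d * (sqrt n * sqrt (2 * (n * ln 2 + L) / d)) \<le> n * (117852/100000) + n * (2 * y)"
      using n by simp
    moreover have "sqrt d * R = n * x + sqrt d * (sqrt n * sqrt (2 * (n * ln 2 + L) / d))"
      by (simp add: R_def nx algebra_simps)
    ultimately show ?thesis by (simp add: algebra_simps)
  qed
  have "ln (32::real) = 5 * ln 2"
    using ln_realpow[of 2 5] by simp
  then have "d * ln 32 \<le> n * x\<^sup>2 * (125/36)"
    unfolding xx using ln2_le_25_over_36 d by (intro mult_left_mono) auto
  moreover have "21/20 * sqrt d * (1361/1000 * A + R * (2/31)) =
      21/20 * (1361/1000 * (sqrt d * A) + 2/31 * (sqrt d * R))"
    by (simp add: algebra_simps)
  moreover have "21/20 * (1361/1000 * (sqrt d * A) + 2/31 * (sqrt d * R)) \<le>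
      21/20 * (1361/1000 * (n * (z - x - y)) + 2/31 * (n * (117852/100000 + x + 2 * y)))"
    by (intro mult_left_mono add_mono R) (simp_all add: sA)
  ultimately have "d * ln 32 + 21/20 * sqrt d * (1361/1000 * A + R * (2/31)) - 133/200 * n + L \<le>
     n * x\<^sup>2 * (125/36) + 21/20 * (1361/1000 * (n * (z - x - y)) + 2/31 * (n * (117852/100000 + x + 2 * y)))
      - 133/200 * n + n * (2 * y\<^sup>2)"
    using Ln by argo
  also have "\<dots> = n * (125/36 * x\<^sup>2 + 2 * y\<^sup>2 + 21/20 * (1361/1000 * (z - x - y) + 2/31 * (117852/100000 + x + 2 * y)) - 133/200)"
    by (simp add: algebra_simps)
  also have "\<dots> \<le> 0"
    using net_exponent_nonpos[OF x0 y0 xy z] n by (intro mult_nonneg_nonpos) auto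
  finally show ?thesis by simp
qed

lemma (in prob_space) prob_Int_lower:
  assumes "A \<in> events" "B \<in> events" "prob A \<ge> 1 - a" "prob B \<ge> 1 - b"
  shows "prob (A \<inter> B) \<ge> 1 - (a + b)"
proof -
  have "prob ((space M - A) \<union> (space M - B)) \<le> prob (space M - A) + prob (space M - B)"
    using assms by (intro measure_Un_le) auto
  moreover have "(space M - A) \<union> (space M - B) = space M - (A \<inter> B)" by auto
  moreover have "A \<inter> B \<in> events" using assms by auto
  ultimately show ?thesis using assms by (simp add: prob_compl)
qed

text \<open>One \<delta> is spent on the upper bound \<open>R\<close>, which serves as Lipschitz
  constant, and one on the Chernoff bounds at the points of the net.\<close>

lemma inf_abs_sum_event:
  fixes f :: "'i \<Rightarrow> 'b \<Rightarrow> 'a::euclidean_space" and \<delta> :: real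
  assumes N: "\<And>i. prob_space (N i)" and I: "finite I" "J \<subseteq> I" and J: "J \<noteq> {}" and \<delta>: "0 < \<delta>" "\<delta> < 1"
    and f: "\<And>i. i \<in> J \<Longrightarrow> f i \<in> borel_measurable (N i)"
    and distr: "\<And>i. i \<in> J \<Longrightarrow> distr (N i) borel (f i) = uniform_sphere"
    and d: "DIM('a) \<ge> 2" and A: "calA (card J) DIM('a) \<delta> > 0"
  shows "\<exists>G\<in>sets (PiM I N). measure (PiM I N) G \<ge> 1 - 2 * \<delta> \<and>
    (\<forall>\<omega>\<in>G. \<forall>u. 1361/1000 * calA (card J) DIM('a) \<delta> * norm u \<le> (\<Sum>i\<in>J. \<bar>u \<bullet> f i (\<omega> i)\<bar>))"
proof -
  interpret N: prob_space "N i" for i by (rule N)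
  interpret P: product_prob_space N I by unfold_locales
  define n where "n = card J"
  define L where "L = ln (1 / \<delta>)"
  define R where "R = sqrt n * (1 + sqrt (2 * (n * ln 2 + L) / DIM('a)))"
  \<comment> \<open>The loss \<open>R * (2/31)\<close> in passing from the net to all directions is
    added in advance.\<close>
  define \<tau> where "\<tau> = 1361/1000 * calA n DIM('a) \<delta> + R * (2/31)"
  have L: "L > 0" using \<delta> by (simp add: L_def)
  have eL: "exp (- L) = \<delta>" using \<delta> by (simp add: L_def ln_div)
  have n: "n \<ge> 1" using J I finite_subset[of J I] by (simp add: n_def Suc_le_eq card_gt_0_iff)
  have R0: "R \<ge> 0" using L by (simp add: R_def)
  have via: "(\<integral>\<^sup>+x. h (f i x) \<partial>N i) = (\<integral>\<^sup>+u. h u \<partial>uniform_sphere)" if "i \<in> J" "h \<in> borel_measurable borel" for i h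
    unfolding distr[OF that(1), symmetric] using f[OF that(1)] that(2) by (subst nn_integral_distr) auto
  have mgf: "(\<integral>\<^sup>+x. ennreal (exp (w \<bullet> f i x)) \<partial>N i) \<le> ennreal (exp ((norm w)\<^sup>2 / (2 * DIM('a))))"
    if "i \<in> J" for i w
    using via[OF that, of "\<lambda>u. ennreal (exp (w \<bullet> u))"] uniform_sphere_mgf[of w] by simp
  have "\<exists>G\<in>P.events. P.prob G \<ge> 1 - \<delta> \<and> (\<forall>\<omega>\<in>G. \<forall>u. (\<Sum>i\<in>J. \<bar>u \<bullet> f i (\<omega> i)\<bar>) \<le> R * norm u)"
    unfolding R_def n_def L_def by (rule sup_abs_sum_event_delta[OF N I J \<delta> f mgf])
  then obtain G1 where G1: "G1 \<in> P.events" "P.prob G1 \<ge> 1 - \<delta>"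
      "\<And>\<omega> u. \<omega> \<in> G1 \<Longrightarrow> (\<Sum>i\<in>J. \<bar>u \<bullet> f i (\<omega> i)\<bar>) \<le> R * norm u"
    by auto
  obtain S :: "'a set" where S: "finite S" "S \<subseteq> sphere 0 1" "real (card S) \<le> (1 + 2 / (2/31)) ^ DIM('a)"
      "\<And>u. norm u = 1 \<Longrightarrow> \<exists>v\<in>S. dist u v \<le> 2/31"
    using sphere_net[of "2/31"] by auto
  define B where "B v = {\<omega>\<in>space (PiM I N). (\<Sum>i\<in>J. \<bar>v \<bullet> f i (\<omega> i)\<bar>) \<le> \<tau>}" for v
  define p where "p = exp (21/20 * sqrt DIM('a) * \<tau>) * exp (- (133/200)) ^ n"
  have fm: "(\<lambda>\<omega>. f i (\<omega> i)) \<in> borel_measurable (PiM I N)" if "i \<in> J" for i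
    using measurable_compose[OF measurable_component_singleton[of i I N] f[of i]] that I by auto
  have "B v \<in> P.events" for v
  proof -
    have "(\<lambda>\<omega>. \<Sum>i\<in>J. \<bar>v \<bullet> f i (\<omega> i)\<bar>) \<in> borel_measurable (PiM I N)"
      by (intro borel_measurable_sum borel_measurable_abs borel_measurable_inner borel_measurable_const fm)
    then show ?thesis unfolding B_def by measurable
  qed
  moreover have "P.prob (B v) \<le> p" if "v \<in> S" for v
    unfolding B_def p_def n_def
  proof (rule abs_sum_lower_tail[OF N I _ _ f])
    fix i assume i: "i \<in> J"
    have "norm v = 1" using S(2) that by auto
    have "(\<integral>\<^sup>+x. ennreal (exp (- (21/20 * sqrt DIM('a) * \<bar>v \<bullet> f i x\<bar>))) \<partial>N i) =
       (\<integral>\<^sup>+u. ennreal (exp (- (21/20 * sqrt DIM('a) * \<bar>v \<bullet> u\<bar>))) \<partial>uniform_sphere)"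
      by (rule via[OF i]) measurable
    also have "\<dots> \<le> (\<integral>\<^sup>+t. ennreal (std_normal_density t * exp (- (21/20 * \<bar>t\<bar>))) \<partial>lborel)"
      by (rule uniform_sphere_exp_neg_abs[OF _ \<open>norm v = 1\<close>]) simp
    also note half_normal_laplace_bound
    finally show "(\<integral>\<^sup>+x. ennreal (exp (- (21/20 * sqrt DIM('a) * \<bar>v \<bullet> f i x\<bar>))) \<partial>N i) \<le> ennreal (exp (- (133/200)))" .
  qed auto
  ultimately obtain G2 where G2: "G2 \<in> P.events" "P.prob G2 \<ge> 1 - card S * p"
      "\<And>\<omega> v. \<omega> \<in> G2 \<Longrightarrow> v \<in> S \<Longrightarrow> \<omega> \<notin> B v"
    using P.finite_union_bound_event[OF S(1), of B p] by blast
  have "card S * p \<le> 32 ^ DIM('a) * p"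
    using S(3) by (intro mult_right_mono) (auto simp: p_def)
  also have "\<dots> = exp (DIM('a) * ln 32 + 21/20 * sqrt DIM('a) * \<tau> - 133/200 * n)"
  proof -
    have "(32::real) ^ DIM('a) = exp (DIM('a) * ln 32)" by (simp add: exp_of_nat_mult)
    moreover have "exp (- (133/200)) ^ n = exp (- (133/200 * n) :: real)"
      by (simp add: exp_of_nat_mult[symmetric] mult.commute)
    ultimately show ?thesis by (simp add: p_def mult_exp_exp)
  qed
  also have "\<dots> \<le> exp (- L)"
    using net_union_bound[of n "DIM('a)" L] n d L A
    unfolding \<tau>_def R_def calA_def n_def[symmetric] L_def[symmetric]
    by (simp only: exp_le_cancel_iff)
  finally have "P.prob G2 \<ge> 1 - \<delta>" using G2(2) eL by simp
  with G1 G2 have prob: "P.prob (G1 \<inter> G2) \<ge> 1 - 2 * \<delta>"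
    using P.prob_Int_lower[of G1 G2 \<delta> \<delta>] by simp
  have "1361/1000 * calA n DIM('a) \<delta> * norm u \<le> (\<Sum>i\<in>J. \<bar>u \<bullet> f i (\<omega> i)\<bar>)" if \<omega>: "\<omega> \<in> G1 \<inter> G2" for \<omega> u
  proof -
    have "\<omega> \<in> space (PiM I N)" using G1(1) \<omega> sets.sets_into_space by blast
    then have "(\<tau> - R * (2/31)) * norm u \<le> (\<Sum>i\<in>J. \<bar>u \<bullet> f i (\<omega> i)\<bar>)"
      using G1(3)[of \<omega>] G2(3)[of \<omega>] \<omega> R0 S(4)
      by (intro abs_sum_lower_from_net[where S=S]) (simp_all add: B_def not_le less_imp_le)
    then show ?thesis by (simp add: \<tau>_def)
  qed
  then show ?thesis using prob G1(1) G2(1) unfolding n_def by (intro bexI[of _ "G1 \<inter> G2"]) auto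
qed

section \<open>Deterministic separation of the Innovation Values\<close>

lemma orthonormal_columns:
  fixes U :: "real^'r^'m"
  assumes orth: "transpose U ** U = mat 1"
  shows "transpose U *v (U *v a) = a" "norm (U *v a) = norm a" "c \<bullet> (U *v a) = (transpose U *v c) \<bullet> a"
proof -
  show 1: "transpose U *v (U *v a) = a" for a
    by (simp add: matrix_vector_mul_assoc orth)
  show 2: "c \<bullet> (U *v a) = (transpose U *v c) \<bullet> a" for c a
    by (metis dot_lmul_matrix transpose_matrix_vector)
  have "(norm (U *v a))\<^sup>2 = (norm a)\<^sup>2"
    unfolding power2_norm_eq_inner 2 1 ..
  then show "norm (U *v a) = norm a" by simp
qed

text \<open>The positions \<open>A\<close> held by inliers are downward closed, because an outlier
  in front of an inlier would contradict \<open>lt\<close>; so they form an initial segment of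
  length \<open>ni\<close>, however ties within each group are broken.\<close>

lemma recovers_if_inliers_first:
  fixes \<omega> :: "nat \<Rightarrow> real^'m" and Iv :: "nat \<Rightarrow> real"
  assumes lt: "\<And>i j. no \<le> i \<Longrightarrow> i < no + ni \<Longrightarrow> j < no \<Longrightarrow> Iv i < Iv j"
    and span: "span (\<omega> ` {no..<no + ni}) = V" and dim: "dim V = r"
  shows "recovers \<omega> (no + ni) Iv r V"
  unfolding recovers_def
proof (intro allI impI)
  fix \<sigma> assume \<sigma>: "bij_betw \<sigma> {..<no + ni} {..<no + ni} \<and>
    (\<forall>k l. k \<le> l \<and> l < no + ni \<longrightarrow> Iv (\<sigma> k) \<le> Iv (\<sigma> l))"
  define A where "A = {t. t < no + ni \<and> no \<le> \<sigma> t}"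
  have rng: "\<sigma> t < no + ni" if "t < no + ni" for t
    using \<sigma> that by (auto simp: bij_betw_def)
  have down: "s \<in> A" if "t \<in> A" "s \<le> t" for s t
  proof (rule ccontr)
    assume "s \<notin> A"
    with that have s: "\<sigma> s < no" by (auto simp: A_def)
    have "Iv (\<sigma> t) < Iv (\<sigma> s)" using that rng[of t] s by (intro lt) (auto simp: A_def)
    moreover have "Iv (\<sigma> s) \<le> Iv (\<sigma> t)" using \<sigma> that by (auto simp: A_def)
    ultimately show False by simp
  qed
  have img: "\<sigma> ` A = {no..<no + ni}"
  proof
    show "\<sigma> ` A \<subseteq> {no..<no + ni}" using rng by (auto simp: A_def)
    show "{no..<no + ni} \<subseteq> \<sigma> ` A"
    proof
      fix i assume i: "i \<in> {no..<no + ni}"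
      then have "i \<in> \<sigma> ` {..<no + ni}" using \<sigma> by (auto simp: bij_betw_def)
      with i show "i \<in> \<sigma> ` A" by (auto simp: A_def)
    qed
  qed
  have "inj_on \<sigma> A" using \<sigma> by (auto simp: bij_betw_def A_def inj_on_def)
  then have "card A = ni" using img by (metis card_image card_atLeastLessThan diff_add_inverse)
  moreover have "finite A" by (simp add: A_def)
  have "A = {..<card A}"
  proof (cases "A = {}")
    case False
    have "A = {..Max A}"
    proof
      show "A \<subseteq> {..Max A}" using \<open>finite A\<close> by auto
      show "{..Max A} \<subseteq> A" using down[OF Max_in[OF \<open>finite A\<close> False]] by auto
    qed
    then show ?thesis by (metis card_atMost lessThan_Suc_atMost)
  qed simp
  ultimately have A: "A = {..<ni}" by simp
  define W where "W k = span ((\<lambda>t. \<omega> (\<sigma> t)) ` {..<k})" for k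
  have "(\<lambda>t. \<omega> (\<sigma> t)) ` {..<ni} = \<omega> ` {no..<no + ni}"
    by (simp add: img[symmetric] A image_image)
  then have Wn: "W ni = V" by (simp add: W_def span)
  have mono: "W k \<subseteq> W l" if "k \<le> l" for k l
    unfolding W_def using that by (intro span_mono image_mono) auto
  \<comment> \<open>The dimension may reach \<open>r\<close> before all inliers are used. A subspace
    of \<open>V\<close> of full dimension is already \<open>V\<close>.\<close>
  define k where "k = (LEAST k. dim (W k) = r)"
  have k: "dim (W k) = r" unfolding k_def by (rule LeastI[of _ ni]) (simp add: Wn dim)
  have kn: "k \<le> ni" unfolding k_def by (rule Least_le) (simp add: Wn dim)
  have least: "dim (W k') < r" if "k' < k" for k'
  proof -
    have "dim (W k') \<noteq> r" using that not_less_Least unfolding k_def by blast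
    moreover have "dim (W k') \<le> dim (W k)" using that by (intro dim_subset mono) auto
    ultimately show ?thesis using k by simp
  qed
  have "W k = V"
    using mono[OF kn] k dim Wn
    by (intro subspace_dim_equal) (auto simp: W_def)
  then show "\<exists>k\<le>no + ni. dim (span ((\<lambda>t. \<omega> (\<sigma> t)) ` {..<k})) = r \<and>
      (\<forall>k'<k. dim (span ((\<lambda>t. \<omega> (\<sigma> t)) ` {..<k'})) < r) \<and> span ((\<lambda>t. \<omega> (\<sigma> t)) ` {..<k}) = V"
    using k kn least unfolding W_def by (intro exI[of _ k]) auto
qed

text \<open>A vector \<open>U *v a\<close> orthogonal to all inliers makes the sum in
  \<open>lower\<close> vanish at \<open>a\<close>, hence is 0. So the orthogonal complement of the
  span within the subspace is trivial.\<close>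

lemma span_inliers:
  fixes U :: "real^'r^'m" and \<omega> :: "nat \<Rightarrow> real^'m"
  assumes orth: "transpose U ** U = mat 1" and K: "K > 0"
    and inl: "\<And>i. i \<in> J \<Longrightarrow> U *v (transpose U *v \<omega> i) = \<omega> i"
    and lower: "\<And>w. K * norm w \<le> (\<Sum>i\<in>J. \<bar>w \<bullet> (transpose U *v \<omega> i)\<bar>)"
  shows "span (\<omega> ` J) = range (\<lambda>a. U *v a)"
proof
  have sub: "subspace (range (\<lambda>a. U *v a))"
    by (intro linear_subspace_image matrix_vector_mul_linear subspace_UNIV)
  have "\<omega> ` J \<subseteq> range (\<lambda>a. U *v a)"
  proof
    fix x assume "x \<in> \<omega> ` J"
    then obtain i where "i \<in> J" "x = \<omega> i" by auto
    then have "x = U *v (transpose U *v \<omega> i)" using inl by simp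
    then show "x \<in> range (\<lambda>a. U *v a)" by blast
  qed
  then show le: "span (\<omega> ` J) \<subseteq> range (\<lambda>a. U *v a)"
    by (rule span_minimal[OF _ sub])
  show "range (\<lambda>a. U *v a) \<subseteq> span (\<omega> ` J)"
  proof
    fix x assume x: "x \<in> range (\<lambda>a. U *v a)"
    obtain y z where y: "y \<in> span (\<omega> ` J)" and z: "\<And>w. w \<in> span (\<omega> ` J) \<Longrightarrow> orthogonal z w" and xyz: "x = y + z"
      using orthogonal_subspace_decomp_exists[of "\<omega> ` J" x] by blast
    have "z \<in> range (\<lambda>a. U *v a)"
      using subspace_diff[OF sub x] le y xyz by (metis add_diff_cancel_left' subsetD)
    then obtain a where a: "z = U *v a" by auto
    have "a \<bullet> (transpose U *v \<omega> i) = 0" if "i \<in> J" for i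
    proof -
      have "0 = z \<bullet> \<omega> i" using z[of "\<omega> i"] that by (simp add: orthogonal_def span_base)
      also have "\<dots> = (transpose U *v \<omega> i) \<bullet> a"
        unfolding a by (subst inner_commute) (rule orthonormal_columns(3)[OF orth])
      finally show ?thesis by (simp add: inner_commute)
    qed
    then have "K * norm a \<le> 0" using lower[of a] by simp
    then have "a = 0" using K by (simp add: mult_le_0_iff)
    then have "z = 0" by (simp add: a)
    then show "x \<in> span (\<omega> ` J)" using y xyz by simp
  qed
qed

lemma innovation_value_separation:
  fixes U :: "real^'r^'m" and \<omega> c :: "nat \<Rightarrow> real^'m" and S K :: real
  assumes orth: "transpose U ** U = mat 1" and no: "no \<ge> 1" and ni: "ni \<ge> 1"
    and out: "\<And>j. j < no \<Longrightarrow> norm (\<omega> j) = 1"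
    and proj: "\<And>j. j < no \<Longrightarrow> norm (transpose U *v \<omega> j) \<le> 1 / 2"
    and inl: "\<And>i. i \<in> {no..<no + ni} \<Longrightarrow> U *v (transpose U *v \<omega> i) = \<omega> i"
      "\<And>i. i \<in> {no..<no + ni} \<Longrightarrow> norm (transpose U *v \<omega> i) = 1"
    and upper: "\<And>u. (\<Sum>j<no. \<bar>u \<bullet> \<omega> j\<bar>) \<le> S * norm u"
    and lower: "\<And>w. K * norm w \<le> (\<Sum>i\<in>{no..<no + ni}. \<bar>w \<bullet> (transpose U *v \<omega> i)\<bar>)"
    and S: "S \<ge> 0" and SK: "2 * S < sqrt 3 * K"
    and opt: "\<And>j. j < no + ni \<Longrightarrow> is_opt_point \<omega> (no + ni) j (c j)"
  shows "Max ((\<lambda>i. innovation_value \<omega> (no + ni) (c i)) ` {no..<no + ni})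
      < Min ((\<lambda>j. innovation_value \<omega> (no + ni) (c j)) ` {..<no})"
    and "recovers \<omega> (no + ni) (\<lambda>j. innovation_value \<omega> (no + ni) (c j)) CARD('r) (range (\<lambda>a. U *v a))"
proof -
  have "sqrt 3 * K > 0" using S SK by linarith
  then have K: "K > 0" by (simp add: zero_less_mult_iff)
  have split: "l1_obj \<omega> (no + ni) u = (\<Sum>j<no. \<bar>u \<bullet> \<omega> j\<bar>) + (\<Sum>i\<in>{no..<no + ni}. \<bar>u \<bullet> \<omega> i\<bar>)" for u
    unfolding l1_obj_def lessThan_atLeast0 by (simp add: sum.atLeastLessThan_concat)
  have inner: "u \<bullet> \<omega> i = (transpose U *v u) \<bullet> (transpose U *v \<omega> i)" if "i \<in> {no..<no + ni}" for u i
    using orthonormal_columns(3)[OF orth, of u "transpose U *v \<omega> i"] inl(1)[OF that] by simp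
  have cost_in: "K \<le> l1_obj \<omega> (no + ni) (c i)" if i: "i \<in> {no..<no + ni}" for i
  proof -
    let ?w = "transpose U *v c i"
    have "1 = c i \<bullet> \<omega> i" using opt[of i] i by (simp add: is_opt_point_def)
    also have "\<dots> = ?w \<bullet> (transpose U *v \<omega> i)" by (rule inner[OF i])
    also have "\<dots> \<le> norm ?w * norm (transpose U *v \<omega> i)" by (rule norm_cauchy_schwarz)
    finally have "1 \<le> norm ?w" using inl(2)[OF i] by simp
    then have "K \<le> K * norm ?w" using K by simp
    also have "\<dots> \<le> (\<Sum>k\<in>{no..<no + ni}. \<bar>?w \<bullet> (transpose U *v \<omega> k)\<bar>)" by (rule lower)
    also have "\<dots> = (\<Sum>k\<in>{no..<no + ni}. \<bar>c i \<bullet> \<omega> k\<bar>)"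
      by (intro sum.cong) (auto simp: inner)
    also have "\<dots> \<le> l1_obj \<omega> (no + ni) (c i)"
      unfolding split by (simp add: sum_nonneg)
    finally show ?thesis .
  qed
  have cost_out: "l1_obj \<omega> (no + ni) (c j) < K" if j: "j < no" for j
  proof -
    define p where "p = \<omega> j - U *v (transpose U *v \<omega> j)"
    let ?y = "transpose U *v \<omega> j"
    have Up: "transpose U *v p = 0"
      unfolding p_def matrix_vector_mult_diff_distrib orthonormal_columns(1)[OF orth] by simp
    have pU: "p \<bullet> (U *v a) = 0" for a
      using orthonormal_columns(3)[OF orth, of p a] Up by simp
    have pp: "p \<bullet> \<omega> j = p \<bullet> p"
      using pU[of ?y] by (simp add: p_def inner_diff_right)
    have "p \<bullet> p = \<omega> j \<bullet> \<omega> j - ?y \<bullet> ?y"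
    proof -
      have "p \<bullet> p = \<omega> j \<bullet> \<omega> j - \<omega> j \<bullet> (U *v ?y)"
        unfolding pp[symmetric] by (simp add: p_def inner_diff_left inner_diff_right inner_commute)
      also have "\<omega> j \<bullet> (U *v ?y) = ?y \<bullet> ?y" by (rule orthonormal_columns(3)[OF orth])
      finally show ?thesis .
    qed
    moreover have "\<omega> j \<bullet> \<omega> j = 1" using out[OF j] by (simp add: dot_square_norm)
    moreover have "?y \<bullet> ?y \<le> 1 / 4"
      using power_mono[OF proj[OF j], of 2] by (simp add: dot_square_norm power2_eq_square)
    ultimately have p34: "p \<bullet> p \<ge> 3 / 4" by linarith
    then have "3 \<le> (2 * norm p)\<^sup>2" by (simp add: dot_square_norm power_mult_distrib)
    then have np: "sqrt 3 \<le> 2 * norm p" by (intro real_le_lsqrt) auto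
    \<comment> \<open>Feasible because \<open>p \<bullet> \<omega> j = p \<bullet> p\<close>, and of
      norm \<open>1 / norm p\<close>.\<close>
    define c' where "c' = p /\<^sub>R (p \<bullet> p)"
    have "p \<noteq> 0" using p34 by auto
    then have "c' \<bullet> \<omega> j = 1" using pp by (simp add: c'_def)
    then have "l1_obj \<omega> (no + ni) (c j) \<le> l1_obj \<omega> (no + ni) c'"
      using opt[of j] j by (simp add: is_opt_point_def)
    also have "\<dots> = (\<Sum>j<no. \<bar>c' \<bullet> \<omega> j\<bar>)"
    proof -
      have "c' \<bullet> \<omega> i = 0" if "i \<in> {no..<no + ni}" for i
        using pU[of "transpose U *v \<omega> i"] inl(1)[OF that] by (simp add: c'_def)
      then show ?thesis unfolding split by simp
    qed
    also have "\<dots> \<le> S * norm c'" by (rule upper)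
    also have "norm c' = 1 / norm p"
      using \<open>p \<noteq> 0\<close> by (simp add: c'_def dot_square_norm power2_eq_square field_simps)
    also have "S * (1 / norm p) < K"
    proof -
      have "norm p > 0" using \<open>p \<noteq> 0\<close> by simp
      have "sqrt 3 * K \<le> 2 * norm p * K" using np K by (intro mult_right_mono) auto
      then have "S < K * norm p" using SK by (simp add: mult_ac)
      then show ?thesis using \<open>norm p > 0\<close> by (simp add: divide_less_eq)
    qed
    finally show ?thesis .
  qed
  \<comment> \<open>A cost of 0 would produce the default value \<open>1 / 0 = 0\<close> and spoil
    the order reversal; the constraint excludes it.\<close>
  have pos: "l1_obj \<omega> (no + ni) (c j) > 0" if "j < no" for j
  proof -
    have "1 = \<bar>c j \<bullet> \<omega> j\<bar>" using opt[of j] that by (simp add: is_opt_point_def)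
    also have "\<dots> \<le> l1_obj \<omega> (no + ni) (c j)"
      unfolding l1_obj_def using that by (intro member_le_sum) auto
    finally show ?thesis by simp
  qed
  have lt: "innovation_value \<omega> (no + ni) (c i) < innovation_value \<omega> (no + ni) (c j)"
    if "no \<le> i" "i < no + ni" "j < no" for i j
    unfolding innovation_value_def
    using cost_in[of i] cost_out[of j] pos[of j] that by (intro divide_strict_left_mono) auto
  show "Max ((\<lambda>i. innovation_value \<omega> (no + ni) (c i)) ` {no..<no + ni})
      < Min ((\<lambda>j. innovation_value \<omega> (no + ni) (c j)) ` {..<no})"
    using no ni lt by (subst Max_less_iff) (auto simp: Min_gr_iff lessThan_empty_iff)
  have inj: "inj (\<lambda>a. U *v a)"
    by (rule inj_on_inverseI[of _ "\<lambda>x. transpose U *v x"]) (rule orthonormal_columns(1)[OF orth])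
  have "dim (range (\<lambda>a. U *v a)) = CARD('r)"
    using dim_image_eq[OF matrix_vector_mul_linear[of U], of UNIV] inj by (simp add: dim_UNIV)
  then show "recovers \<omega> (no + ni) (\<lambda>j. innovation_value \<omega> (no + ni) (c j)) CARD('r) (range (\<lambda>a. U *v a))"
    using lt span_inliers[OF orth K inl(1) lower] by (intro recovers_if_inliers_first) auto
qed

section \<open>Assembling the events\<close>

lemma measurable_matrix_vector_mult [measurable]:
  "(\<lambda>x. A *v x) \<in> borel_measurable borel" for A :: "real^'n^'k"
  by (intro borel_measurable_continuous_onI linear_continuous_on linear_conv_bounded_linear[THEN iffD1]
      matrix_vector_mul_linear)

lemma AE_uniform_sphere_norm: "AE u in (uniform_sphere :: 'a::euclidean_space measure). norm u = 1"
proof (rule AE_I)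
  \<comment> \<open>The origin is the only point that \<open>radial\<close> does not send to the
    sphere, as it is mapped to 0.\<close>
  have "{x::'a. norm x < 1 \<and> radial x \<in> {u. norm u \<noteq> 1}} \<subseteq> {0}"
    using norm_radial by auto
  then have "emeasure lborel {x::'a. norm x < 1 \<and> radial x \<in> {u. norm u \<noteq> 1}} \<le> emeasure lborel {0::'a}"
    by (intro emeasure_mono) auto
  then have "emeasure lborel {x::'a. norm x < 1 \<and> radial x \<in> {u. norm u \<noteq> 1}} = 0" by simp
  moreover have "{u::'a. norm u \<noteq> 1} \<in> sets borel" by measurable
  ultimately show "emeasure (uniform_sphere :: 'a measure) {u. norm u \<noteq> 1} = 0"
    by (simp only: emeasure_uniform_sphere ennreal_zero_divide)
  show "{u::'a. norm u \<noteq> 1} \<in> sets uniform_sphere" by measurable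
qed auto

lemma sets_uniform_subspace_sphere [simp, measurable_cong]: "sets (uniform_subspace_sphere U) = sets borel"
  by (simp add: uniform_subspace_sphere_def)

lemma space_uniform_subspace_sphere [simp]: "space (uniform_subspace_sphere U) = UNIV"
  by (simp add: uniform_subspace_sphere_def)

lemma prob_space_uniform_subspace_sphere: "prob_space (uniform_subspace_sphere U)"
  unfolding uniform_subspace_sphere_def
  by (intro prob_space.prob_space_distr prob_space_uniform_sphere) measurable

text \<open>In the coordinates given by the basis, the inliers are uniform on the sphere of
  dimension \<open>r\<close>, so \<open>inf_abs_sum_event\<close> applies to them with
  \<open>r\<close> as the dimension.\<close>

lemma distr_uniform_subspace_sphere:
  fixes U :: "real^'r^'m"
  assumes orth: "transpose U ** U = mat 1"
  shows "distr (uniform_subspace_sphere U) borel (\<lambda>x. transpose U *v x) = uniform_sphere"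
proof -
  have "distr (uniform_subspace_sphere U) borel (\<lambda>x. transpose U *v x) =
      distr uniform_sphere borel ((\<lambda>x. transpose U *v x) \<circ> (\<lambda>a. U *v a))"
    unfolding uniform_subspace_sphere_def by (rule distr_distr) measurable
  also have "(\<lambda>x. transpose U *v x) \<circ> (\<lambda>a. U *v a) = (\<lambda>a. a)"
    unfolding o_def orthonormal_columns(1)[OF orth] ..
  finally show ?thesis by (simp add: distr_id2)
qed

lemma AE_uniform_subspace_sphere:
  fixes U :: "real^'r^'m"
  assumes orth: "transpose U ** U = mat 1"
  shows "AE x in uniform_subspace_sphere U. U *v (transpose U *v x) = x \<and> norm (transpose U *v x) = 1"
proof -
  have m: "{x. U *v (transpose U *v x) = x \<and> norm (transpose U *v x) = 1} \<in> sets borel"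
    by measurable
  have "AE a in (uniform_sphere :: (real^'r) measure).
      U *v (transpose U *v (U *v a)) = U *v a \<and> norm (transpose U *v (U *v a)) = 1"
    unfolding orthonormal_columns(1)[OF orth] using AE_uniform_sphere_norm by simp
  then show ?thesis
    unfolding uniform_subspace_sphere_def
    by (subst AE_distr_iff) (use m in auto)
qed

text \<open>Since \<open>U\<close> is an isometry, the projection inherits the variance proxy
  \<open>1 / M\<close> but lives in only \<open>r\<close> dimensions, so its typical norm is
  \<open>sqrt (r / M) < 1/3\<close>. The gap up to 1/2 gives
  \<open>sqrt r * t \<ge> sqrt M / 6\<close>, hence the exponent \<open>M / 72\<close>.\<close>

lemma projection_tail:
  fixes U :: "real^'r^'m"
  assumes orth: "transpose U ** U = mat 1" and r: "9 * real CARD('r) < real CARD('m)"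
    and p: "0 < p" "72 * ln (1 / p) \<le> real CARD('m)"
  shows "measure (uniform_sphere :: (real^'m) measure) {x. 1 / 2 \<le> norm (transpose U *v x)} \<le> p"
proof -
  define M where "M = real CARD('m)"
  define r where "r = real CARD('r)"
  \<comment> \<open>The deviation at which the threshold of \<open>norm_tail_of_mgf\<close> equals
    1/2.\<close>
  define t where "t = sqrt M / (2 * sqrt r) - 1"
  have r0: "r > 0" by (simp add: r_def)
  have M: "M > 9 * r" using r by (simp add: M_def r_def)
  then have M0: "M > 0" using r0 by simp
  have sr: "sqrt r > 0" "3 * sqrt r < sqrt M"
    using r0 M real_sqrt_less_mono[of "9 * r" M] by (auto simp: real_sqrt_mult)
  have "2 * sqrt r < sqrt M" using sr by linarith
  then have t: "t > 0" using sr(1) by (simp add: t_def field_simps)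
  have st: "1 / sqrt M * sqrt r * (1 + t) = 1 / 2"
    using sr M0 r0 by (simp add: t_def)
  have "measure (uniform_sphere :: (real^'m) measure)
      {x\<in>space uniform_sphere. norm (transpose U *v x) \<ge> 1 / sqrt M * sqrt DIM(real^'r) * (1 + t)} \<le>
      exp (- (DIM(real^'r) * t\<^sup>2 / 2))"
  proof (rule norm_tail_of_mgf[OF prob_space_uniform_sphere _ _ t])
    show "1 / sqrt M > 0" using M0 by simp
    fix w :: "real^'r"
    have "(\<integral>\<^sup>+x. ennreal (exp (w \<bullet> (transpose U *v x))) \<partial>uniform_sphere) =
        (\<integral>\<^sup>+x. ennreal (exp ((U *v w) \<bullet> x)) \<partial>uniform_sphere)"
      by (subst (1 2) inner_commute) (simp only: orthonormal_columns(3)[OF orth])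
    also have "\<dots> \<le> ennreal (exp ((norm (U *v w))\<^sup>2 / (2 * DIM(real^'m))))"
      by (rule uniform_sphere_mgf)
    also have "(norm (U *v w))\<^sup>2 / (2 * DIM(real^'m)) = (1 / sqrt M)\<^sup>2 * (norm w)\<^sup>2 / 2"
      unfolding orthonormal_columns(2)[OF orth] using M0 by (simp add: M_def power_divide)
    finally show "(\<integral>\<^sup>+x. ennreal (exp (w \<bullet> (transpose U *v x))) \<partial>uniform_sphere) \<le>
       ennreal (exp ((1 / sqrt M)\<^sup>2 * (norm w)\<^sup>2 / 2))" .
  qed measurable
  also have "sqrt DIM(real^'r) = sqrt r" by (simp add: r_def)
  also note st
  also have "exp (- (DIM(real^'r) * t\<^sup>2 / 2)) \<le> exp (- ln (1 / p))"
  proof -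
    have "sqrt r * t = sqrt M / 2 - sqrt r" using sr by (simp add: t_def field_simps)
    then have "sqrt M / 6 \<le> sqrt r * t" using sr by linarith
    then have "(sqrt M / 6)\<^sup>2 \<le> (sqrt r * t)\<^sup>2" using M0 by (intro power_mono) auto
    then have "M / 36 \<le> r * t\<^sup>2" using r0 M0 by (simp add: power_mult_distrib power_divide)
    then show ?thesis using p(2) by (simp add: r_def M_def)
  qed
  also have "exp (- ln (1 / p)) = p" using p by (simp add: ln_div)
  finally show ?thesis by simp
qed

text \<open>The first and the last argument of the maximum in \<open>sqrt_c_delta\<close>, squared:
  the factor 3 yields 9, and 72 is 9 times 8. These are exactly the inputs of
  \<open>projection_tail\<close>.\<close>

lemma c_delta_bounds:
  fixes M r n \<delta> :: real
  assumes r: "r > 0" and M: "M > 1" and big: "M > c_delta M r n \<delta> * r" and L: "ln (n / \<delta>) \<ge> 0"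
  shows "9 * r < M" "72 * ln (n / \<delta>) < M"
proof -
  let ?b = "8 * M * ln (n / \<delta>) / ((M - 1) * r)"
  have b: "?b \<ge> 0" using r M L by simp
  have le: "(3 * s)\<^sup>2 \<le> c_delta M r n \<delta>" if "s \<ge> 0" "s \<le> 1 \<or> s \<le> sqrt ?b" for s
    unfolding c_delta_def sqrt_c_delta_def using that by (intro power_mono mult_left_mono) auto
  have "9 * r \<le> c_delta M r n \<delta> * r"
    using le[of 1] r by (intro mult_right_mono) (auto simp: power2_eq_square)
  then show "9 * r < M" using big by simp
  have "9 * ?b * r \<le> c_delta M r n \<delta> * r"
    using le[of "sqrt ?b"] r b by (intro mult_right_mono) (auto simp: power_mult_distrib)
  then have "9 * ?b * r < M" using big by simp
  moreover have "9 * ?b * r = M * (72 * ln (n / \<delta>) / (M - 1))" using r M by (simp add: field_simps)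
  ultimately have "M * (72 * ln (n / \<delta>) / (M - 1)) < M * 1" by simp
  then have "72 * ln (n / \<delta>) / (M - 1) < 1" using M by (subst (asm) mult_less_cancel_left_pos) auto
  then have "72 * ln (n / \<delta>) < M - 1" using M by (simp add: divide_less_eq)
  then show "72 * ln (n / \<delta>) < M" by simp
qed

text \<open>The right side of the hypothesis increases with \<open>k\<close>, so it may be lowered
  to \<open>k = 1\<close>. What remains is a comparison of the coefficients of \<open>a\<close>,
  \<open>sqrt n\<close> and \<open>b\<close>.\<close>

lemma outlier_cost_bound:
  fixes n M L k A :: real
  assumes n: "n \<ge> 1" and M: "M > 1" and L: "L > 0" and k: "k \<ge> 1"
    and A: "A > k * n / sqrt M + 2 * sqrt n * (1 + sqrt k) + 2 * sqrt (2 * k * n * L / (M - 1))"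
  shows "2 * (sqrt n * (1 + sqrt (2 * (n * ln 2 + L) / M))) < sqrt 3 * (1361/1000 * A)"
proof -
  define a where "a = n / sqrt M"
  define b where "b = sqrt (2 * n * L / M)"
  have a0: "a \<ge> 0" and b0: "b \<ge> 0" using n M L by (auto simp: a_def b_def)
  have sn: "sqrt n > 0" using n by simp
  have "sqrt n * sqrt (2 * (n * ln 2 + L) / M) = sqrt (n\<^sup>2 * (2 * ln 2) / M + 2 * n * L / M)"
    by (simp add: real_sqrt_mult[symmetric] power2_eq_square algebra_simps add_divide_distrib)
  also have "\<dots> \<le> sqrt (n\<^sup>2 * (2 * ln 2) / M) + b"
    unfolding b_def using n M L by (intro sqrt_add_le_add_sqrt) auto
  also have "sqrt (n\<^sup>2 * (2 * ln 2) / M) = a * sqrt (2 * ln 2)"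
    using n by (simp add: a_def real_sqrt_mult real_sqrt_divide)
  also have "sqrt (2 * ln 2) \<le> 117852/100000"
    using ln2_le_25_over_36 by (intro real_le_lsqrt) (auto simp: power2_eq_square)
  finally have S: "sqrt n * sqrt (2 * (n * ln 2 + L) / M) \<le> a * (117852/100000) + b"
    using a0 by (simp add: mult_left_mono)
  have "a \<le> k * n / sqrt M"
    using k n M by (simp add: a_def divide_right_mono)
  moreover have "4 * sqrt n \<le> 2 * sqrt n * (1 + sqrt k)"
    using k sn mult_left_mono[of 2 "1 + sqrt k" "2 * sqrt n"] by simp
  moreover have "b \<le> sqrt (2 * k * n * L / (M - 1))"
    unfolding b_def
  proof (rule real_sqrt_le_mono)
    have "2 * n * L / M \<le> 2 * n * L / (M - 1)"
      using n M L by (intro divide_left_mono) auto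
    also have "\<dots> \<le> 2 * k * n * L / (M - 1)"
      using n M L k by (intro divide_right_mono mult_right_mono) auto
    finally show "2 * n * L / M \<le> 2 * k * n * L / (M - 1)" .
  qed
  ultimately have A': "a + 4 * sqrt n + 2 * b < A" using A by argo
  have s3: "1732/1000 \<le> sqrt (3::real)"
    by (intro real_le_rsqrt) (simp add: power2_eq_square)
  have "2 * (sqrt n * (1 + sqrt (2 * (n * ln 2 + L) / M))) \<le> 2 * (sqrt n + (a * (117852/100000) + b))"
    using S by (simp add: distrib_left)
  \<comment> \<open>Only the coefficient of \<open>a\<close> is tight: 2.35704 on the left against
    2.357252 on the right.\<close>
  also have "\<dots> \<le> 1732/1000 * (1361/1000 * (a + 4 * sqrt n + 2 * b))"
    using a0 b0 sn by (simp add: field_simps)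
  also have "\<dots> < 1732/1000 * (1361/1000 * A)" using A' by simp
  also have "\<dots> \<le> sqrt 3 * (1361/1000 * A)"
  proof (rule mult_right_mono[OF s3])
    show "0 \<le> 1361/1000 * A" using A' a0 b0 sn by linarith
  qed
  finally show ?thesis .
qed

theorem theorem1:
  fixes Ub :: "real^'r^'m"
    and no ni :: nat
    and \<delta> :: real
    and c :: "(nat \<Rightarrow> real^'m) \<Rightarrow> nat \<Rightarrow> real^'m"
  assumes delta: "0 < \<delta>" "\<delta> < 1"
    and orth: "transpose Ub ** Ub = mat 1"
    and r_ge: "CARD('r) \<ge> 2"
    and M1_big: "real CARD('m) > c_delta (real CARD('m)) (real CARD('r)) (real no) \<delta> * real CARD('r)"
    and no_pos: "no \<ge> 1"
    and ni_pos: "ni \<ge> 1"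
  shows "\<exists>E \<in> sets (data_measure no ni Ub).
     measure (data_measure no ni Ub) E \<ge> 1 - 7 * \<delta> \<and>
     (\<forall>\<omega>\<in>E.
        (\<forall>j<no + ni. is_opt_point \<omega> (no + ni) j (c \<omega> j))
        \<and> cond_i (real CARD('m)) (real CARD('r)) (real no) (real ni) \<delta> (real (nz' no \<omega> (c \<omega>)))
        \<and> cond_ii (real CARD('m)) (real CARD('r)) (real no) (real ni) \<delta> (real (nz' no \<omega> (c \<omega>)))
        \<and> cond_iii (real CARD('m)) (real CARD('r)) (real no) (real ni) \<delta> (chi no (c \<omega>))
        \<longrightarrow>
        Max ((\<lambda>i. innovation_value \<omega> (no + ni) (c \<omega> i)) ` {no..<no + ni})
          < Min ((\<lambda>j. innovation_value \<omega> (no + ni) (c \<omega> j)) ` {..<no})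
        \<and> recovers \<omega> (no + ni) (\<lambda>j. innovation_value \<omega> (no + ni) (c \<omega> j)) CARD('r)
            (range (\<lambda>a. Ub *v a)))"
proof -
  define M where "M = real CARD('m)"
  define L where "L = ln (1 / \<delta>)"
  define I where "I = {..<no + ni}"
  define N where "N j = (if j < no then (uniform_sphere :: (real^'m) measure) else uniform_subspace_sphere Ub)" for j
  define K where "K = 1361/1000 * calA ni CARD('r) \<delta>"
  define S where "S = sqrt no * (1 + sqrt (2 * (no * ln 2 + L) / M))"
  have data: "data_measure no ni Ub = PiM I N"
    by (simp add: data_measure_def I_def N_def[abs_def])
  have N: "prob_space (N i)" for i
    by (simp add: N_def prob_space_uniform_sphere prob_space_uniform_subspace_sphere)
  have setsN: "sets (N i) = sets borel" "space (N i) = UNIV" for i by (simp_all add: N_def)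
  interpret N: prob_space "N i" for i by (rule N)
  interpret P: product_prob_space N I by unfold_locales
  have L: "L > 0" using delta by (simp add: L_def)
  have nod: "no / \<delta> > 1" using delta no_pos by (simp add: field_simps)
  have c9: "c_delta M CARD('r) no \<delta> \<ge> 9"
    unfolding c_delta_def sqrt_c_delta_def
    using power_mono[of 3 "3 * max 1 (max (sqrt (8 * M * pi / ((M - 1) * CARD('r)))) (sqrt (8 * M * ln (no / \<delta>) / ((M - 1) * CARD('r)))))" 2]
    by (simp add: power2_eq_square)
  have M1: "M > 1"
  proof -
    have "9 * 2 \<le> c_delta M CARD('r) no \<delta> * CARD('r)"
      using c9 r_ge by (intro mult_mono) auto
    then show ?thesis using M1_big by (simp add: M_def)
  qed
  have bounds: "9 * CARD('r) < M" "72 * ln (no / \<delta>) < M"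
    using c_delta_bounds[of "CARD('r)" M no \<delta>] M1 M1_big nod by (auto simp: M_def)
  \<comment> \<open>Cauchy-Schwarz in the constraint of the first outlier, which is a unit
    vector.\<close>
  have chi_ge: "1 \<le> chi no (c \<omega>)" if "norm (\<omega> 0) = 1" "is_opt_point \<omega> (no + ni) 0 (c \<omega> 0)" for \<omega>
  proof -
    have "1 = c \<omega> 0 \<bullet> \<omega> 0" using that(2) by (simp add: is_opt_point_def)
    also have "\<dots> \<le> norm (c \<omega> 0)" using norm_cauchy_schwarz[of "c \<omega> 0" "\<omega> 0"] that(1) by simp
    also have "\<dots> \<le> chi no (c \<omega>)" unfolding chi_def using no_pos by (intro Max_ge) auto
    finally show ?thesis .
  qed
  show ?thesis
  proof (cases "calA ni CARD('r) \<delta> > 0")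
    case False
    have "\<not> cond_iii M CARD('r) no ni \<delta> (chi no (c \<omega>))" for \<omega>
    proof -
      have "0 \<le> norm (c \<omega> 0)" by simp
      also have "\<dots> \<le> chi no (c \<omega>)" unfolding chi_def using no_pos by (intro Max_ge) auto
      finally have "0 \<le> chi no (c \<omega>) * no / sqrt M + 2 * sqrt no * (1 + sqrt (chi no (c \<omega>)))
          + 2 * sqrt (2 * chi no (c \<omega>) * no * ln (1 / \<delta>) / (M - 1))"
        using M1 L by (intro add_nonneg_nonneg mult_nonneg_nonneg divide_nonneg_nonneg) (auto simp: L_def)
      then show ?thesis using False by (simp add: cond_iii_def)
    qed
    then show ?thesis
      unfolding data M_def
      using delta P.P.prob_space by (intro bexI[of _ "space (PiM I N)"]) auto
  next
    case True
    have up_mgf: "(\<integral>\<^sup>+x. ennreal (exp (w \<bullet> x)) \<partial>N i) \<le> ennreal (exp ((norm w)\<^sup>2 / (2 * DIM(real^'m))))"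
      if "i \<in> {..<no}" for i and w :: "real^'m"
      using uniform_sphere_mgf[of w] that by (simp add: N_def)
    have "\<exists>G\<in>P.events. P.prob G \<ge> 1 - \<delta> \<and>
        (\<forall>\<omega>\<in>G. \<forall>u. (\<Sum>i\<in>{..<no}. \<bar>u \<bullet> \<omega> i\<bar>) \<le> S * norm u)"
      using sup_abs_sum_event_delta[OF N, of I "{..<no}" \<delta> "\<lambda>_ x. x"] up_mgf delta no_pos
      by (simp add: S_def M_def L_def I_def lessThan_empty_iff setsN measurable_ident_sets)
    then obtain G1 where G1: "G1 \<in> P.events" "P.prob G1 \<ge> 1 - \<delta>"
        "\<And>\<omega> u. \<omega> \<in> G1 \<Longrightarrow> (\<Sum>i<no. \<bar>u \<bullet> \<omega> i\<bar>) \<le> S * norm u"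
      by auto
    have UN: "distr (N i) borel (\<lambda>x. transpose Ub *v x) = uniform_sphere" if "i \<in> {no..<no + ni}" for i
      using distr_uniform_subspace_sphere[OF orth] that by (simp add: N_def)
    have "\<exists>G\<in>P.events. P.prob G \<ge> 1 - 2 * \<delta> \<and>
        (\<forall>\<omega>\<in>G. \<forall>u. 1361/1000 * calA (card {no..<no + ni}) DIM(real^'r) \<delta> * norm u \<le>
          (\<Sum>i\<in>{no..<no + ni}. \<bar>u \<bullet> (transpose Ub *v \<omega> i)\<bar>))"
    proof (rule inf_abs_sum_event[OF N _ _ _ delta _ UN])
      show "(\<lambda>x. transpose Ub *v x) \<in> borel_measurable (N i)" for i
        using measurable_matrix_vector_mult[of "transpose Ub"] by (simp add: measurable_cong_sets[OF setsN(1) refl])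
      show "0 < calA (card {no..<no + ni}) DIM(real^'r) \<delta>" using True by simp
    qed (use ni_pos r_ge in \<open>auto simp: I_def\<close>)
    then obtain G2 where G2: "G2 \<in> P.events" "P.prob G2 \<ge> 1 - 2 * \<delta>"
        "\<And>\<omega> u. \<omega> \<in> G2 \<Longrightarrow> K * norm u \<le> (\<Sum>i\<in>{no..<no + ni}. \<bar>u \<bullet> (transpose Ub *v \<omega> i)\<bar>)"
      by (auto simp: K_def)
    define B where "B j = {\<omega>\<in>space (PiM I N). \<omega> j \<in> {x. 1 / 2 \<le> norm (transpose Ub *v x)}}" for j
    have Bm: "{x. 1 / 2 \<le> norm (transpose Ub *v x)} \<in> sets borel" by measurable
    have B: "B j \<in> P.events" "P.prob (B j) \<le> \<delta> / no" if j: "j < no" for j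
    proof -
      have jI: "j \<in> I" using j by (simp add: I_def)
      show "B j \<in> P.events"
      proof -
        have "B j = (\<lambda>\<omega>. \<omega> j) -` {x. 1 / 2 \<le> norm (transpose Ub *v x)} \<inter> space (PiM I N)"
          unfolding B_def by blast
        also have "\<dots> \<in> P.events"
          by (rule measurable_sets[OF measurable_component_singleton[OF jI, of N]]) (simp only: setsN Bm)
        finally show ?thesis .
      qed
      have "emeasure (PiM I N) (B j) = emeasure (N j) {x. 1 / 2 \<le> norm (transpose Ub *v x)}"
        unfolding B_def using Bm jI by (intro P.emeasure_PiM_Collect_single) (auto simp: setsN)
      then have "P.prob (B j) = measure (uniform_sphere :: (real^'m) measure) {x. 1 / 2 \<le> norm (transpose Ub *v x)}"
        using j by (simp add: measure_def N_def)
      \<comment> \<open>With this probability the logarithm in \<open>projection_tail\<close> is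
        \<open>ln (no / \<delta>)\<close>, and the union over all outliers costs \<delta>.\<close>
      also have "\<dots> \<le> \<delta> / no"
        using delta no_pos bounds by (intro projection_tail[OF orth]) (auto simp: M_def)
      finally show "P.prob (B j) \<le> \<delta> / no" .
    qed
    obtain G3 where G3: "G3 \<in> P.events" "P.prob G3 \<ge> 1 - \<delta>"
        "\<And>\<omega> j. \<omega> \<in> G3 \<Longrightarrow> j < no \<Longrightarrow> \<omega> \<notin> B j"
      using P.finite_union_bound_event[of "{..<no}" B "\<delta> / no"] B no_pos by auto
    have "AE \<omega> in PiM I N. (\<forall>j\<in>{..<no}. norm (\<omega> j) = 1) \<and>
        (\<forall>i\<in>{no..<no + ni}. Ub *v (transpose Ub *v \<omega> i) = \<omega> i \<and> norm (transpose Ub *v \<omega> i) = 1)"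
    proof (intro AE_conjI AE_finite_allI)
      fix j assume "j \<in> {..<no}"
      then have "N j = uniform_sphere" "j \<in> I" by (auto simp: N_def I_def)
      then show "AE \<omega> in PiM I N. norm (\<omega> j) = 1"
        by (intro P.AE_component[where P="\<lambda>x. norm x = 1"]) (simp_all only: AE_uniform_sphere_norm)
    next
      fix i assume i: "i \<in> {no..<no + ni}"
      have "AE \<omega> in PiM I N. Ub *v (transpose Ub *v \<omega> i) = \<omega> i \<and> norm (transpose Ub *v \<omega> i) = 1"
      proof (rule P.AE_component[where P="\<lambda>x. Ub *v (transpose Ub *v x) = x \<and> norm (transpose Ub *v x) = 1"])
        have "N i = uniform_subspace_sphere Ub" using i by (simp add: N_def)
        then show "AE x in N i. Ub *v (transpose Ub *v x) = x \<and> norm (transpose Ub *v x) = 1"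
          by (simp only: AE_uniform_subspace_sphere[OF orth])
      qed (use i in \<open>auto simp: I_def\<close>)
      then show "AE \<omega> in PiM I N. Ub *v (transpose Ub *v \<omega> i) = \<omega> i"
        "AE \<omega> in PiM I N. norm (transpose Ub *v \<omega> i) = 1" by auto
    qed auto
    \<comment> \<open>Unit length and membership in the subspace hold only almost surely. A
      measurable null set covering the exceptions is removed, so that they hold at every sample of
      \<open>E\<close>.\<close>
    then obtain Z where Z: "{\<omega>\<in>space (PiM I N). \<not> ((\<forall>j\<in>{..<no}. norm (\<omega> j) = 1) \<and>
        (\<forall>i\<in>{no..<no + ni}. Ub *v (transpose Ub *v \<omega> i) = \<omega> i \<and> norm (transpose Ub *v \<omega> i) = 1))} \<subseteq> Z"
        "emeasure (PiM I N) Z = 0" "Z \<in> P.events"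
      by (rule AE_E)
    define G4 where "G4 = space (PiM I N) - Z"
    have G4: "G4 \<in> P.events" "P.prob G4 \<ge> 1 - 0"
      using Z(2,3) by (auto simp: G4_def P.prob_compl P.emeasure_eq_measure)
    define E where "E = G1 \<inter> (G2 \<inter> (G3 \<inter> G4))"
    \<comment> \<open>The failure probabilities are \<delta> for the outlier supremum, 2\<delta> for
      the inlier infimum, \<delta> for the projections and 0 for the null set.\<close>
    have "P.prob (G3 \<inter> G4) \<ge> 1 - (\<delta> + 0)" by (rule P.prob_Int_lower[OF G3(1) G4(1) G3(2) G4(2)])
    then have "P.prob (G2 \<inter> (G3 \<inter> G4)) \<ge> 1 - (2 * \<delta> + (\<delta> + 0))"
      by (rule P.prob_Int_lower[OF G2(1) sets.Int[OF G3(1) G4(1)] G2(2)])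
    then have "P.prob E \<ge> 1 - (\<delta> + (2 * \<delta> + (\<delta> + 0)))"
      unfolding E_def by (rule P.prob_Int_lower[OF G1(1) sets.Int[OF G2(1) sets.Int[OF G3(1) G4(1)]] G1(2)])
    then have probE: "P.prob E \<ge> 1 - 7 * \<delta>" using delta by simp
    have Eev: "E \<in> P.events" unfolding E_def using G1(1) G2(1) G3(1) G4(1) by auto
    have concl: "Max ((\<lambda>i. innovation_value \<omega> (no + ni) (c \<omega> i)) ` {no..<no + ni})
          < Min ((\<lambda>j. innovation_value \<omega> (no + ni) (c \<omega> j)) ` {..<no})
        \<and> recovers \<omega> (no + ni) (\<lambda>j. innovation_value \<omega> (no + ni) (c \<omega> j)) CARD('r) (range (\<lambda>a. Ub *v a))"
      if \<omega>: "\<omega> \<in> E" and opt: "\<And>j. j < no + ni \<Longrightarrow> is_opt_point \<omega> (no + ni) j (c \<omega> j)"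
        and iii: "cond_iii M CARD('r) no ni \<delta> (chi no (c \<omega>))" for \<omega>
    proof -
      have sp: "\<omega> \<in> space (PiM I N)" using Eev \<omega> sets.sets_into_space by blast
      have as: "\<And>j. j < no \<Longrightarrow> norm (\<omega> j) = 1"
        "\<And>i. i \<in> {no..<no + ni} \<Longrightarrow> Ub *v (transpose Ub *v \<omega> i) = \<omega> i"
        "\<And>i. i \<in> {no..<no + ni} \<Longrightarrow> norm (transpose Ub *v \<omega> i) = 1"
        using Z(1) \<omega> sp by (auto simp: E_def G4_def)
      have proj: "norm (transpose Ub *v \<omega> j) \<le> 1 / 2" if "j < no" for j
        using G3(3)[of \<omega> j] that \<omega> sp by (auto simp: E_def B_def)
      have up: "(\<Sum>i<no. \<bar>u \<bullet> \<omega> i\<bar>) \<le> S * norm u" for u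
        using G1(3) \<omega> by (simp add: E_def)
      have low: "K * norm u \<le> (\<Sum>i\<in>{no..<no + ni}. \<bar>u \<bullet> (transpose Ub *v \<omega> i)\<bar>)" for u
        using G2(3) \<omega> by (simp add: E_def)
      have S0: "S \<ge> 0" using L M1 by (simp add: S_def)
      have "1 \<le> chi no (c \<omega>)" using as(1)[of 0] opt[of 0] no_pos by (intro chi_ge) auto
      then have "2 * S < sqrt 3 * K"
        unfolding S_def K_def using iii no_pos M1 L
        by (intro outlier_cost_bound) (auto simp: cond_iii_def L_def)
      from innovation_value_separation[OF orth no_pos ni_pos as(1) proj as(2,3) up low S0 this opt]
      show ?thesis by blast
    qed
    show ?thesis
      unfolding data using probE Eev concl unfolding M_def by (intro bexI[of _ E]) blast+
  qed
qed

end
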